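(* Let $d\ge 1$ and let $\alpha=(\alpha_1,\dots,\alpha_{\ell(\alpha)})$ be a partition of $d$ with $\ell(\alpha)$ parts. Then the genus zero monotone single Hurwitz number $\vec{H}_0(\alpha)$ is given by $$\vec{H}_0(\alpha)=\frac{d!}{|\mathrm{Aut}\,\alpha|}\,(2d+1)^{\overline{\ell(\alpha)-3}}\;\prod_{j=1}^{\ell(\alpha)}\binom{2\alpha_j}{\alpha_j}.$$
   Context: For a partition $\alpha\vdash d$ with $\ell(\alpha)$ parts and an integer $r\ge 0$, the monotone single Hurwitz number $\vec{H}^r(\alpha)$ is the number of factorizations $(a_1\,b_1)(a_2\,b_2)\cdots(a_r\,b_r)=\sigma$ in the symmetric group $S_d$ (i.e. the number of sequences of $r$ transpositions, $\sigma$ being their product) such that: each $(a_i\,b_i)$ is a transposition, written with $a_i<b_i$; $\sigma$ has cycle type $\alpha$; the subgroup $\langle (a_1\,b_1),\dots,(a_r\,b_r)\rangle$ acts transitively on $\{1,\dots,d\}$; and $b_1\le b_2\le\cdots\le b_r$. For $g\ge 0$ set $\vec{H}_g(\alpha)=\vec{H}^r(\alpha)$ with $r=d+\ell(\alpha)+2g-2$; in particular $\vec{H}_0(\alpha)=\vec{H}^{d+\ell(\alpha)-2}(\alpha)$. $|\mathrm{Aut}\,\alpha|=\prod_{j\ge1}m_j(\alpha)!$, where $m_j(\alpha)$ is the number of parts of $\alpha$ equal to $j$. For $k\ge 0$, $x^{\overline{k}}=x(x+1)\cdots(x+k-1)$ is the rising product with $k$ factors, so $(2d+1)^{\overline{k}}=(2d+1)(2d+2)\cdots(2d+k)$;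 for $k<0$, by convention $(2d+1)^{\overline{k}}=\dfrac{1}{(2d+k+1)^{\overline{-k}}}$. *)

theory Defs
  imports Complex_Main "HOL-Library.Multiset" "HOL-Combinatorics.Orbits" "HOL-Algebra.Sym_Groups"
begin

text \<open>A partition is the multiset of its (positive) parts; \<open>size \<alpha>\<close> is its number of parts.\<close>

definition partition_of :: "nat multiset \<Rightarrow> nat \<Rightarrow> bool" where
  "partition_of \<alpha> d \<longleftrightarrow> 0 \<notin># \<alpha> \<and> sum_mset \<alpha> = d"

text \<open>Parts of multiplicity zero would only contribute factors \<open>0! = 1\<close>.\<close>

definition aut_order :: "nat multiset \<Rightarrow> nat" where
  "aut_order \<alpha> = (\<Prod>j\<in>set_mset \<alpha>. fact (count \<alpha> j))"

text \<open>The image is a set, so every orbit is counted once; fixed points give parts \<open>1\<close>.\<close>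

definition cycle_type :: "nat \<Rightarrow> (nat \<Rightarrow> nat) \<Rightarrow> nat multiset" where
  "cycle_type d \<sigma> = image_mset card (mset_set (orbit \<sigma> ` {1..d}))"

definition transitive_on :: "nat \<Rightarrow> (nat \<Rightarrow> nat) set \<Rightarrow> bool" where
  "transitive_on d H \<longleftrightarrow> (\<forall>x\<in>{1..d}. \<forall>y\<in>{1..d}. \<exists>h\<in>H. h x = y)"

definition transpositions :: "(nat \<times> nat) list \<Rightarrow> (nat \<Rightarrow> nat) list" where
  "transpositions ts = map (\<lambda>(a, b). Transposition.transpose a b) ts"

text \<open>
  Products are taken in \<open>sym_group d\<close>, i.e. with respect to \<open>\<circ>\<close>. Multiplying in the opposite order
  inverts the product and hence leaves its cycle type unchanged.
\<close>

definition monotone_factorizations :: "nat \<Rightarrow> nat multiset \<Rightarrow> (nat \<times> nat) list set" where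
  "monotone_factorizations r \<alpha> = (let d = sum_mset \<alpha> in
     {ts. length ts = r \<and>
          (\<forall>(a, b)\<in>set ts. 1 \<le> a \<and> a < b \<and> b \<le> d) \<and>
          cycle_type d (foldr (mult (sym_group d)) (transpositions ts) (one (sym_group d))) = \<alpha> \<and>
          transitive_on d (generate (sym_group d) (set (transpositions ts))) \<and>
          sorted (map snd ts)})"

definition monotone_hurwitz :: "nat \<Rightarrow> nat multiset \<Rightarrow> nat" where
  "monotone_hurwitz r \<alpha> = card (monotone_factorizations r \<alpha>)"

text \<open>The truncated subtraction is harmless: \<open>sum_mset \<alpha> + size \<alpha> \<ge> 2\<close> for nonempty \<open>\<alpha>\<close> without
  zero parts.\<close>

definition monotone_hurwitz_genus :: "nat \<Rightarrow> nat multiset \<Rightarrow> nat" where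
  "monotone_hurwitz_genus g \<alpha> = monotone_hurwitz (sum_mset \<alpha> + size \<alpha> + 2 * g - 2) \<alpha>"

text \<open>
  The rising product \<open>x (x + 1) \<cdots> (x + k - 1)\<close>, extended to negative \<open>k\<close>. For \<open>x = 2 d + 1\<close> and
  \<open>k < 0\<close> it is the reciprocal of the rising product with \<open>-k\<close> factors starting at \<open>2 d + k + 1\<close>.
\<close>

definition rising :: "real \<Rightarrow> int \<Rightarrow> real" where
  "rising x k = (if k \<ge> 0 then pochhammer x (nat k) else 1 / pochhammer (x + of_int k) (nat (- k)))"

end

theory Submission
  imports Defs "HOL-Computational_Algebra.Formal_Power_Series"
begin

text \<open>
  In a transitive monotone factorization of a permutation of \<open>d \<ge> 2\<close> points the last transposition is
  \<open>(a d)\<close>. Dropping it leaves either a transitive factorization, and then (in genus zero) the cycle of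
  \<open>d\<close> was cut in two, or two transitive factorizations on complementary sets, each determined by its
  trace on the sequence, whose cycles through \<open>d\<close> and \<open>a\<close> were joined. Marking the length \<open>k\<close> of the
  cycle of \<open>d\<close>, the number \<open>n(k, \<beta>)\<close> of genus zero factorizations with other cycle lengths \<open>\<beta>\<close>,
  divided by \<open>(d - 1)!\<close>, satisfies
  \<open>n(k, \<beta>) = (\<Sum>m\<in>\<beta>. n(k + m, \<beta> - m)) + (\<Sum>i + j = k. \<Sum>\<gamma> + \<delta> = \<beta>. n(i, \<gamma>) * n(j, \<delta>))\<close>,
  the first sum running over the distinct parts of \<open>\<beta>\<close>. Here the marked point \<open>a\<close> of the second
  component is arbitrary; this costs nothing because by induction the count is proportional to the
  number of points in cycles of length \<open>j\<close>.

  The solution is \<open>n(k, \<beta>) = k * C(2k, k) * (\<Prod>b\<in>\<beta>. C(2b, b)) / |Aut \<beta>|\<close> times the rising product of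
  \<open>|\<beta>| - 2\<close> factors from \<open>2d + 1\<close>. To verify this, each such rising product is expanded in the functions
  \<open>X (X + 2 b\<^sub>1 + \<dots> + 2 b\<^sub>n + 1) \<cdots> (X + 2 b\<^sub>1 + \<dots> + 2 b\<^sub>n + n - 1)\<close>, which are of binomial type, so
  that only convolutions of central binomial coefficients remain.
\<close>

subsection \<open>Convolution over sub-multisets\<close>

text \<open>Relabelling the points destroys monotonicity, so no symmetry makes all points equally
  likely to lie on a cycle of a given length. That the maximum behaves like an average point can
  only come out of the explicit formula, during the induction. It also explains the normalization: a
  piece on s points with an arbitrary marked point contributes s!, the piece with the maximum of the
  n + 1 points contributes (n - s)!, and the (n choose s) ways to place them turn this into n!.

  Behind the functions of binomial type is a power series F in variables p_m, defined by F = 1 + sum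
  over m of C(2m, m) p_m F^(2m + 1): \<open>hurwitz X \<beta>\<close> is the coefficient of the
  monomial p_\<beta> in F^X. The numbers n(k, \<beta>) for fixed k do not form a power of F, but
  C(2k - 2, k - 1) times the series F^(2k) / k - sum over m of (2m + 1) C(2m, m) p_m F^(2k + 2m) /
  (k + m). Products of two such series again involve only powers of F, with rational coefficients
  that partial fractions resolve.\<close>

lemma finite_submultisets: "finite {\<gamma>. \<gamma> \<subseteq># (\<beta> :: 'a multiset)}"
proof (rule finite_subset)
  show "{\<gamma>. \<gamma> \<subseteq># \<beta>} \<subseteq> (\<Union>n\<le>size \<beta>. {\<gamma>. set_mset \<gamma> \<subseteq> set_mset \<beta> \<and> size \<gamma> = n})"
    by (auto simp: size_mset_mono dest: mset_subset_eqD)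
qed (use finite_multisets_of_size[of "set_mset \<beta>"] in \<open>auto simp: multisets_of_size_def\<close>)

lemma sum_count_eq_sum_mset:
  fixes \<phi> :: "'a \<Rightarrow> real"
  shows "(\<Sum>m\<in>set_mset \<beta>. real (count \<beta> m) * \<phi> m) = (\<Sum>m\<in>#\<beta>. \<phi> m)"
proof (induction \<beta>)
  case (add x \<beta>)
  have "(\<Sum>m\<in>set_mset (add_mset x \<beta>). real (count (add_mset x \<beta>) m) * \<phi> m) =
     (\<Sum>m\<in>set_mset (add_mset x \<beta>). real (count \<beta> m) * \<phi> m + (if m = x then \<phi> m else 0))"
    by (intro sum.cong) (auto simp: algebra_simps)
  also have "\<dots> = (\<Sum>m\<in>set_mset (add_mset x \<beta>). real (count \<beta> m) * \<phi> m) + \<phi> x"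
    by (simp add: sum.distrib del: set_mset_add_mset_insert) simp
  also have "(\<Sum>m\<in>set_mset (add_mset x \<beta>). real (count \<beta> m) * \<phi> m) = (\<Sum>m\<in>set_mset \<beta>. real (count \<beta> m) * \<phi> m)"
    by (rule sum.mono_neutral_right) (auto simp: not_in_iff)
  finally show ?case using add by simp
qed simp

lemma double_complement_mset: "\<gamma> \<subseteq># \<beta> \<Longrightarrow> \<beta> - (\<beta> - \<gamma>) = \<gamma>"
  by (auto simp: multiset_eq_iff subseteq_mset_def)

text \<open>The product of formal power series, \<open>f \<gamma>\<close> being the coefficient of
  the monomial \<gamma>; hence each sub-multiset is summed once, without binomial weights.\<close>

definition convolve :: "('a multiset \<Rightarrow> real) \<Rightarrow> ('a multiset \<Rightarrow> real) \<Rightarrow> 'a multiset \<Rightarrow> real" where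
  "convolve f g \<beta> = (\<Sum>\<gamma> | \<gamma> \<subseteq># \<beta>. f \<gamma> * g (\<beta> - \<gamma>))"

text \<open>As a power series: the sum over m of the variable p_m times the series
  \<open>u m\<close>. A monomial \<beta> arises once from each distinct m.\<close>

definition shift :: "('a \<Rightarrow> 'a multiset \<Rightarrow> real) \<Rightarrow> 'a multiset \<Rightarrow> real" where
  "shift u \<beta> = (\<Sum>m\<in>set_mset \<beta>. u m (\<beta> - {#m#}))"

lemma convolve_commute: "convolve f g \<beta> = convolve g f \<beta>"
  unfolding convolve_def
  by (rule sum.reindex_bij_witness[where i = "\<lambda>\<gamma>. \<beta> - \<gamma>" and j = "\<lambda>\<gamma>. \<beta> - \<gamma>"])
     (auto simp: double_complement_mset)

text \<open>A factor p_m can be pulled out of a product: choosing \<gamma> inside \<beta> and then a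
  part m of \<gamma> is choosing m in \<beta> and then the rest of \<gamma>.\<close>

lemma convolve_shift_left: "convolve (shift u) g \<beta> = shift (\<lambda>m. convolve (u m) g) \<beta>"
proof -
  have "convolve (shift u) g \<beta> = (\<Sum>(\<gamma>, m)\<in>Sigma {\<gamma>. \<gamma> \<subseteq># \<beta>} set_mset. u m (\<gamma> - {#m#}) * g (\<beta> - \<gamma>))"
    by (simp add: convolve_def shift_def sum_distrib_right finite_submultisets sum.Sigma)
  also have "\<dots> = (\<Sum>(m, \<delta>)\<in>Sigma (set_mset \<beta>) (\<lambda>m. {\<delta>. \<delta> \<subseteq># \<beta> - {#m#}}). u m \<delta> * g (\<beta> - {#m#} - \<delta>))"
    by (rule sum.reindex_bij_witness[where i = "\<lambda>(m, \<delta>). (add_mset m \<delta>, m)" and j = "\<lambda>(\<gamma>, m). (m, \<gamma> - {#m#})"])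
       (auto simp: insert_subset_eq_iff subset_eq_diff_conv insert_DiffM mset_subset_eqD)
  also have "\<dots> = shift (\<lambda>m. convolve (u m) g) \<beta>"
    by (simp add: convolve_def shift_def finite_submultisets sum.Sigma)
  finally show ?thesis .
qed

lemma convolve_shift_right: "convolve f (shift u) \<beta> = shift (\<lambda>m. convolve f (u m)) \<beta>"
proof -
  have "convolve f (shift u) \<beta> = shift (\<lambda>m. convolve (u m) f) \<beta>"
    by (simp only: convolve_commute[of f] convolve_shift_left)
  also have "(\<lambda>m. convolve (u m) f) = (\<lambda>m. convolve f (u m))"
    by (intro ext convolve_commute)
  finally show ?thesis .
qed

lemma convolve_diff_left: "convolve (\<lambda>\<gamma>. f \<gamma> - f' \<gamma>) g \<beta> = convolve f g \<beta> - convolve f' g \<beta>"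
  by (simp add: convolve_def algebra_simps sum_subtractf)

lemma convolve_diff_right: "convolve f (\<lambda>\<gamma>. g \<gamma> - g' \<gamma>) \<beta> = convolve f g \<beta> - convolve f g' \<beta>"
  by (simp add: convolve_def algebra_simps sum_subtractf)

lemma convolve_scale: "convolve (\<lambda>\<gamma>. a * f \<gamma>) (\<lambda>\<gamma>. b * g \<gamma>) \<beta> = a * b * convolve f g \<beta>"
  by (simp add: convolve_def sum_distrib_left algebra_simps)

subsection \<open>Central binomial coefficients\<close>

definition cbin :: "nat \<Rightarrow> real" where
  "cbin b = real ((2 * b) choose b)"

lemma cbin_0 [simp]: "cbin 0 = 1"
  by (simp add: cbin_def)

lemma cbin_Suc: "real (Suc j) * cbin (Suc j) = 2 * real (2 * j + 1) * cbin j"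
proof -
  have 1: "Suc j * ((2 * Suc j) choose Suc j) = (2 * Suc j) * ((2 * j + 1) choose j)"
    using Suc_times_binomial_eq[of "2 * j + 1" j] by (simp add: algebra_simps)
  have 2: "Suc j * ((2 * j + 1) choose j) = (2 * j + 1) * ((2 * j) choose j)"
  proof -
    have "(2 * j + 1) choose j = (2 * j + 1) choose Suc j"
      using binomial_symmetric[of j "2 * j + 1"] by simp
    then show ?thesis using Suc_times_binomial_eq[of "2 * j" j] by (simp add: algebra_simps)
  qed
  have "Suc j * (Suc j * ((2 * Suc j) choose Suc j)) = Suc j * (2 * ((2 * j + 1) * ((2 * j) choose j)))"
    using 1 2 by (metis mult.assoc mult.left_commute)
  then have "Suc j * ((2 * Suc j) choose Suc j) = 2 * ((2 * j + 1) * ((2 * j) choose j))"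
    by (metis mult_left_cancel nat.distinct(1))
  from arg_cong[OF this, of real] show ?thesis
    unfolding cbin_def by (simp only: of_nat_mult mult.assoc of_nat_numeral)
qed

text \<open>These are the coefficients of (1 - 4x)^(-1/2); both sides obey the recurrence
  \<open>cbin_Suc\<close>.\<close>

lemma cbin_eq_gbinomial: "cbin j = (-4) ^ j * ((-1/2 :: real) gchoose j)"
proof (induction j)
  case (Suc j)
  have "real (Suc j) * ((-4) ^ Suc j * ((-1/2 :: real) gchoose Suc j)) =
      (-4) ^ Suc j * (((-1/2) - real j) * ((-1/2) gchoose j))"
    using gbinomial_mult_1[of "-1/2::real" j] by (simp add: algebra_simps)
  also have "\<dots> = 2 * real (2 * j + 1) * ((-4) ^ j * ((-1/2 :: real) gchoose j))"
    by (simp add: algebra_simps)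
  also have "\<dots> = real (Suc j) * cbin (Suc j)"
    using Suc cbin_Suc[of j] by simp
  finally have "real (Suc j) * cbin (Suc j) = real (Suc j) * ((-4) ^ Suc j * ((-1/2 :: real) gchoose Suc j))"
    by (rule sym)
  then show ?case by (metis mult_left_cancel of_nat_eq_0_iff nat.distinct(1))
qed simp

lemma sqrt_coeff_eq_gbinomial: "- cbin j / (2 * real j - 1) = (-4) ^ j * ((1/2 :: real) gchoose j)"
proof (induction j)
  case (Suc j)
  have ne: "2 * real j - 1 \<noteq> 0"
  proof
    assume "2 * real j - 1 = 0"
    then have "real (2 * j) = real 1" by simp
    then show False by (metis One_nat_def of_nat_eq_iff odd_one even_mult_iff even_numeral)
  qed
  have "real (Suc j) * ((-4) ^ Suc j * ((1/2 :: real) gchoose Suc j)) =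
      (-4) ^ Suc j * (((1/2) - real j) * ((1/2) gchoose j))"
    using gbinomial_mult_1[of "1/2::real" j] by (simp add: left_diff_distrib)
  also have "\<dots> = 2 * (2 * real j - 1) * ((-4) ^ j * ((1/2 :: real) gchoose j))"
    by (simp add: algebra_simps)
  also have "\<dots> = - 2 * cbin j"
    unfolding Suc[symmetric] using ne by (simp add: divide_simps)
  also have "\<dots> = real (Suc j) * (- cbin (Suc j) / (2 * real (Suc j) - 1))"
    using cbin_Suc[of j] by (simp add: divide_simps algebra_simps)
  finally have "real (Suc j) * (- cbin (Suc j) / (2 * real (Suc j) - 1)) = real (Suc j) * ((-4) ^ Suc j * ((1/2 :: real) gchoose Suc j))"
    by (rule sym)
  then show ?case by (metis mult_left_cancel of_nat_eq_0_iff nat.distinct(1))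
qed simp

text \<open>Coefficient comparison in (1 - 4x)^(1/2) (1 - 4x)^(-1/2) = 1.\<close>

lemma cbin_sqrt_convolution:
  assumes "M \<ge> 1"
  shows "(\<Sum>j\<le>M. - cbin j / (2 * real j - 1) * cbin (M - j)) = 0"
proof -
  have "(\<Sum>j\<le>M. - cbin j / (2 * real j - 1) * cbin (M - j)) =
    (\<Sum>j\<le>M. (-4) ^ M * (((1/2 :: real) gchoose j) * ((-1/2) gchoose (M - j))))"
  proof (rule sum.cong)
    fix j assume "j \<in> {..M}"
    then have "(-4 :: real) ^ M = (-4) ^ j * (-4) ^ (M - j)"
      by (simp flip: power_add)
    then show "- cbin j / (2 * real j - 1) * cbin (M - j) =
        (-4) ^ M * (((1/2 :: real) gchoose j) * ((-1/2) gchoose (M - j)))"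
      unfolding sqrt_coeff_eq_gbinomial cbin_eq_gbinomial[of "M - j"] by simp
  qed simp
  also have "\<dots> = (-4) ^ M * ((0 :: real) gchoose M)"
    using gbinomial_Vandermonde[of "1/2::real" "-1/2" M]
    by (simp add: atLeast0AtMost flip: sum_distrib_left)
  also have "\<dots> = 0" using assms by (cases M) auto
  finally show ?thesis .
qed

text \<open>The coefficients of \<open>(1 - 4 x) powr (- 1 / 2) * integral of x ^ b * (1 - 4 x) powr (- 1 / 2)\<close>.\<close>

lemma cbin_convolution:
  "2 * (2 * real b + 1) * cbin b * (\<Sum>j\<le>N. cbin j * cbin (N - j) / (real j + 1 + real b)) = cbin (N + b + 1)"
proof (induction b arbitrary: N)
  case 0
  have "0 = (\<Sum>j\<le>Suc N. - cbin j / (2 * real j - 1) * cbin (Suc N - j))"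
    using cbin_sqrt_convolution[of "Suc N"] by simp
  also have "\<dots> = cbin (Suc N) + (\<Sum>j\<le>N. - cbin (Suc j) / (2 * real (Suc j) - 1) * cbin (Suc N - Suc j))"
    by (subst sum.atMost_Suc_shift) (simp)
  also have "(\<Sum>j\<le>N. - cbin (Suc j) / (2 * real (Suc j) - 1) * cbin (Suc N - Suc j)) =
     (\<Sum>j\<le>N. - 2 * (cbin j * cbin (N - j) / (real j + 1)))"
  proof (rule sum.cong)
    fix j
    have "cbin (Suc j) / (2 * real (Suc j) - 1) = 2 * cbin j / (real j + 1)"
      using cbin_Suc[of j] by (simp add: field_simps)
    then show "- cbin (Suc j) / (2 * real (Suc j) - 1) * cbin (Suc N - Suc j) =
        - 2 * (cbin j * cbin (N - j) / (real j + 1))"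
      by (simp)
  qed simp
  also have "\<dots> = - 2 * (\<Sum>j\<le>N. cbin j * cbin (N - j) / (real j + 1))"
    by (simp add: sum_distrib_left)
  finally show ?case by (simp)
next
  case (Suc b)
  define M where "M = Suc N"
  define S where "S = (\<Sum>j\<le>N. cbin j * cbin (N - j) / (real j + 1 + real (Suc b)))"
  have "0 = (\<Sum>j\<le>M. - cbin j / (2 * real j - 1) * cbin (M - j))"
    unfolding M_def using cbin_sqrt_convolution[of "Suc N"] by simp
  also have "\<dots> = cbin M + (\<Sum>j\<le>N. - cbin (Suc j) / (2 * real (Suc j) - 1) * cbin (N - j))"
    unfolding M_def by (subst sum.atMost_Suc_shift) (simp)
  also have "(\<Sum>j\<le>N. - cbin (Suc j) / (2 * real (Suc j) - 1) * cbin (N - j)) =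
     (\<Sum>j\<le>N. (real b + 1) * (cbin (Suc j) * cbin (N - j) / (real (Suc j) + 1 + real b)) -
        (4 * real b + 6) * (cbin j * cbin (N - j) / (real j + 1 + real (Suc b))))"
  proof (rule sum.cong)
    fix j
    have c: "cbin (Suc j) = 2 * (2 * real j + 1) * cbin j / (real j + 1)"
      using cbin_Suc[of j] by (simp add: field_simps)
    \<comment> \<open>Integration by parts: x^(b+1) (1 - 4x)^(1/2) has the derivative (b + 1) x^b (1
      - 4x)^(-1/2) - (4b + 6) x^(b+1) (1 - 4x)^(-1/2). Integrating back and comparing coefficients
      of x^(b+j+2) gives this line.\<close>
    have "- cbin (Suc j) / (2 * real (Suc j) - 1) = (real b + 1) * (cbin (Suc j) / (real (Suc j) + 1 + real b)) -
        (4 * real b + 6) * (cbin j / (real j + 1 + real (Suc b)))"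
      unfolding c by (simp add: divide_simps) (simp add: algebra_simps)
    from arg_cong[OF this, of "\<lambda>x. x * cbin (N - j)"]
    show "- cbin (Suc j) / (2 * real (Suc j) - 1) * cbin (N - j) = (real b + 1) * (cbin (Suc j) * cbin (N - j) / (real (Suc j) + 1 + real b)) -
        (4 * real b + 6) * (cbin j * cbin (N - j) / (real j + 1 + real (Suc b)))"
      by (simp add: algebra_simps)
  qed simp
  also have "\<dots> = (real b + 1) * (\<Sum>j\<le>N. cbin (Suc j) * cbin (N - j) / (real (Suc j) + 1 + real b)) - (4 * real b + 6) * S"
    unfolding S_def by (simp only: sum_subtractf sum_distrib_left)
  \<comment> \<open>The sum for b lacks its term j = 0; multiplied by b + 1, that term cancels the
    leading \<open>cbin M\<close>.\<close>
  also have "(\<Sum>j\<le>N. cbin (Suc j) * cbin (N - j) / (real (Suc j) + 1 + real b)) =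
     (\<Sum>j\<le>M. cbin j * cbin (M - j) / (real j + 1 + real b)) - cbin M / (real b + 1)"
    unfolding M_def by (subst sum.atMost_Suc_shift) (simp add: add.commute)
  also have "(real b + 1) * ((\<Sum>j\<le>M. cbin j * cbin (M - j) / (real j + 1 + real b)) - cbin M / (real b + 1)) =
      (real b + 1) * (\<Sum>j\<le>M. cbin j * cbin (M - j) / (real j + 1 + real b)) - cbin M"
    by (simp add: right_diff_distrib)
  finally have "(4 * real b + 6) * S = (real b + 1) * (\<Sum>j\<le>M. cbin j * cbin (M - j) / (real j + 1 + real b))"
    by linarith
  moreover have "4 * real b + 6 = 2 * (2 * real (Suc b) + 1)" by simp
  ultimately have *: "2 * (2 * real (Suc b) + 1) * S = (real b + 1) * (\<Sum>j\<le>M. cbin j * cbin (M - j) / (real j + 1 + real b))"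
    by metis
  have "2 * (2 * real (Suc b) + 1) * cbin (Suc b) * S =
      cbin (Suc b) * (2 * (2 * real (Suc b) + 1) * S)"
    by (simp only: ac_simps)
  also have "\<dots> =
      cbin (Suc b) * ((real b + 1) * (\<Sum>j\<le>M. cbin j * cbin (M - j) / (real j + 1 + real b)))"
    by (simp only: *)
  also have "\<dots> = (real (Suc b) * cbin (Suc b)) * (\<Sum>j\<le>M. cbin j * cbin (M - j) / (real j + 1 + real b))"
    by (simp)
  also have "\<dots> = 2 * (2 * real b + 1) * cbin b * (\<Sum>j\<le>M. cbin j * cbin (M - j) / (real j + 1 + real b))"
    by (simp only: cbin_Suc) simp
  also have "\<dots> = cbin (M + b + 1)" by (rule Suc)
  finally show ?case unfolding S_def M_def by (simp only: add_Suc add_Suc_right)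
qed

subsection \<open>A Hurwitz identity for rising products\<close>

text \<open>The convention for negative exponents is the one that continues this recurrence
  downwards. For k <= 0 the factor is cancelled against a denominator, so it must not
  vanish.\<close>

lemma rising_step:
  assumes "x + of_int k - 1 \<noteq> 0"
  shows "rising x k = (x + of_int k - 1) * rising x (k - 1)"
proof (cases "k \<ge> 1")
  case True
  define n where "n = nat (k - 1)"
  have k: "k = int n + 1" "nat k = Suc n" using True by (auto simp: n_def)
  show ?thesis using True by (simp add: rising_def k(1) nat_add_distrib pochhammer_rec')
next
  case False
  define n where "n = nat (- k)"
  have k: "k \<le> 0" "\<not> k - 1 \<ge> 0" "nat (- (k - 1)) = Suc n" "k = - int n" using False by (auto simp: n_def)
  have "pochhammer (x + of_int (k - 1)) (Suc n) = (x + of_int (k - 1)) * pochhammer (x + of_int (k - 1) + 1) n"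
    by (rule pochhammer_rec)
  then have *: "pochhammer (x + of_int (k - 1)) (Suc n) = (x + of_int k - 1) * pochhammer (x + of_int k) n"
    by (simp add: algebra_simps)
  have a: "rising x (k - 1) = 1 / pochhammer (x + of_int (k - 1)) (Suc n)"
    using False by (simp only: rising_def k(2,3) if_False)
  have b: "rising x k = 1 / pochhammer (x + of_int k) n"
    using False by (cases n) (auto simp: rising_def k(4) nat_add_distrib)
  show ?thesis using assms unfolding a b * by simp
qed

definition weight :: "nat multiset \<Rightarrow> real" where
  "weight \<beta> = (\<Prod>b\<in>#\<beta>. cbin b) / real (aut_order \<beta>)"

lemma aut_order_pos: "aut_order \<beta> > 0"
  by (simp add: aut_order_def prod_pos)

lemma aut_order_add_mset: "aut_order (add_mset m \<gamma>) = Suc (count \<gamma> m) * aut_order \<gamma>"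
proof -
  have *: "aut_order \<delta> = (\<Prod>j\<in>insert m (set_mset \<gamma>). fact (count \<delta> j))" if "set_mset \<delta> \<subseteq> insert m (set_mset \<gamma>)" for \<delta>
    unfolding aut_order_def by (rule prod.mono_neutral_left) (use that in \<open>auto simp: not_in_iff\<close>)
  have "aut_order (add_mset m \<gamma>) = fact (Suc (count \<gamma> m)) * (\<Prod>j\<in>set_mset \<gamma> - {m}. fact (count \<gamma> j))"
    by (subst *) (auto simp: prod.insert_remove)
  moreover have "aut_order \<gamma> = fact (count \<gamma> m) * (\<Prod>j\<in>set_mset \<gamma> - {m}. fact (count \<gamma> j))"
    by (subst *) (auto simp: prod.insert_remove)
  ultimately show ?thesis by (simp add: algebra_simps)
qed

lemma weight_empty [simp]: "weight {#} = 1"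
  by (simp add: weight_def aut_order_def)

lemma weight_add_mset: "real (Suc (count \<gamma> m)) * weight (add_mset m \<gamma>) = cbin m * weight \<gamma>"
  using aut_order_pos[of \<gamma>] by (simp add: weight_def aut_order_add_mset del: of_nat_Suc mult_Suc)

text \<open>By \<open>weight_add_mset\<close>, \<open>cbin m * weight \<gamma>\<close> is
  \<open>weight \<beta>\<close> times the multiplicity of m in \<beta>. So the automorphism factor
  turns a sum over distinct parts into a sum over all parts.\<close>

lemma shift_weight:
  assumes "\<And>m \<gamma>. \<beta> = add_mset m \<gamma> \<Longrightarrow> u m \<gamma> = cbin m * weight \<gamma> * \<phi> m"
  shows "shift u \<beta> = weight \<beta> * (\<Sum>m\<in>#\<beta>. \<phi> m)"
proof -
  have "u m (\<beta> - {#m#}) = weight \<beta> * (real (count \<beta> m) * \<phi> m)" if m: "m \<in># \<beta>" for m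
  proof -
    obtain \<gamma> where \<gamma>: "\<beta> = add_mset m \<gamma>" using m by (metis mset_add)
    then show ?thesis using assms[OF \<gamma>] weight_add_mset[of \<gamma> m, symmetric] by (simp add: algebra_simps)
  qed
  then show ?thesis
    by (simp add: shift_def sum_count_eq_sum_mset flip: sum_distrib_left)
qed

lemma shift_cong: "(\<And>m \<gamma>. \<beta> = add_mset m \<gamma> \<Longrightarrow> u m \<gamma> = u' m \<gamma>) \<Longrightarrow> shift u \<beta> = shift u' \<beta>"
  unfolding shift_def by (intro sum.cong) (auto simp: insert_DiffM)

text \<open>
  For \<open>\<beta> = {#}\<close> the formula would read \<open>X * (1 / X)\<close>; the case distinction also gives the right
  value at \<open>X = 0\<close>.
\<close>

definition hurwitz :: "real \<Rightarrow> nat multiset \<Rightarrow> real" where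
  "hurwitz X \<beta> = (if \<beta> = {#} then 1
     else weight \<beta> * X * pochhammer (X + 2 * real (sum_mset \<beta>) + 1) (size \<beta> - 1))"

lemma hurwitz_rising:
  assumes "X > 0"
  shows "hurwitz X \<beta> = weight \<beta> * X * rising (X + 2 * real (sum_mset \<beta>) + 1) (int (size \<beta>) - 1)"
proof (cases "\<beta> = {#}")
  case False
  then have "size \<beta> \<ge> 1" by (simp add: Suc_leI nonempty_has_size)
  then have "int (size \<beta>) - 1 \<ge> 0" "nat (int (size \<beta>) - 1) = size \<beta> - 1" by auto
  then show ?thesis using False by (simp add: hurwitz_def rising_def)
qed (use assms in \<open>simp add: hurwitz_def rising_def\<close>)

lemma hurwitz_0: "hurwitz 0 \<beta> = (if \<beta> = {#} then 1 else 0)"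
  by (simp add: hurwitz_def)

lemma sum_mset_const_add: "(\<Sum>m\<in>#\<beta>. a + 2 * real m) = real (size \<beta>) * a + 2 * real (sum_mset \<beta>)"
  by (induction \<beta>) (auto simp: algebra_simps)

text \<open>The equation F^(X+1) - F^X = sum of C(2m, m) p_m F^(X+1+2m). Removing a part m while
  raising X by 2m leaves the base of the rising product unchanged, so all summands share the factor
  \<open>P\<close> and what remains is linear in the parts.\<close>

lemma hurwitz_difference:
  assumes "X \<ge> 0"
  shows "hurwitz (X + 1) \<beta> - hurwitz X \<beta> = shift (\<lambda>m \<gamma>. cbin m * hurwitz (X + 1 + 2 * real m) \<gamma>) \<beta>"
proof (cases "\<beta> = {#}")
  case True
  then show ?thesis by (simp add: hurwitz_def shift_def)
next
  case False
  define S where "S = real (sum_mset \<beta>)"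
  define n where "n = size \<beta> - 1"
  have n: "size \<beta> = Suc n" using False by (simp add: n_def nonempty_has_size)
  define P where "P = rising (X + 2 * S + 2) (int n - 1)"
  have S: "S \<ge> 0" unfolding S_def by (rule of_nat_0_le_iff)
  have "shift (\<lambda>m \<gamma>. cbin m * hurwitz (X + 1 + 2 * real m) \<gamma>) \<beta> = weight \<beta> * (\<Sum>m\<in>#\<beta>. P * (X + 1 + 2 * real m))"
  proof (rule shift_weight)
    fix m \<gamma> assume \<beta>: "\<beta> = add_mset m \<gamma>"
    have "X + 1 + 2 * real m + 2 * real (sum_mset \<gamma>) + 1 = X + 2 * S + 2" "size \<gamma> = n"
      using n by (auto simp: S_def \<beta>)
    then show "cbin m * hurwitz (X + 1 + 2 * real m) \<gamma> = cbin m * weight \<gamma> * (P * (X + 1 + 2 * real m))"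
      using assms by (subst hurwitz_rising) (auto simp: P_def add.commute[of "X + 2 * S" 2] simp del: of_nat_sum_mset)
  qed
  also have "(\<Sum>m\<in>#\<beta>. P * (X + 1 + 2 * real m)) = P * (real (Suc n) * (X + 1) + 2 * S)"
    by (simp only: sum_mset_distrib_left[symmetric] sum_mset_const_add n S_def)
  also have "P * (real (Suc n) * (X + 1) + 2 * S) =
      (X + 1) * pochhammer (X + 1 + 2 * S + 1) n - X * pochhammer (X + 2 * S + 1) n"
  proof (cases n)
    \<comment> \<open>A single part: here \<open>P\<close> has exponent -1 and equals 1 / (X + 2S +
      1).\<close>
    case 0
    then show ?thesis using assms S by (simp add: P_def rising_def)
  next
    case (Suc k)
    have P: "P = pochhammer (X + 2 * S + 2) k"
      by (simp add: P_def Suc rising_def)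
    have 1: "pochhammer (X + 1 + 2 * S + 1) n = (X + 2 * S + 2 + real k) * P"
      unfolding Suc P pochhammer_rec' by (simp add: algebra_simps)
    have 2: "pochhammer (X + 2 * S + 1) n = (X + 2 * S + 1) * P"
      unfolding Suc P pochhammer_rec by (simp add: algebra_simps)
    show ?thesis unfolding 1 2 by (simp add: Suc algebra_simps)
  qed
  finally show ?thesis
    using False by (simp add: hurwitz_def n_def S_def algebra_simps)
qed

text \<open>
  The analogue of Hurwitz's multivariate Abel identity for rising products: both sides agree at
  \<open>X = 0\<close> and satisfy the same difference equation in \<open>X\<close>.
\<close>

lemma hurwitz_convolution: 
  assumes "Y \<ge> 0"
  shows "convolve (hurwitz (real X)) (hurwitz Y) \<beta> = hurwitz (real X + Y) \<beta>"
proof (induction "size \<beta>" arbitrary: \<beta> X rule: less_induct)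
  case less
  note IH = less
  show ?case
  proof (induction X)
    case 0
    have "convolve (hurwitz (real 0)) (hurwitz Y) \<beta> = (\<Sum>\<gamma> | \<gamma> \<subseteq># \<beta>. if \<gamma> = {#} then hurwitz Y \<beta> else 0)"
      unfolding convolve_def by (intro sum.cong) (auto simp: hurwitz_0)
    also have "\<dots> = hurwitz Y \<beta>"
      by (subst sum.delta[OF finite_submultisets]) auto
    finally show ?case by simp
  next
    case (Suc X)
    have "convolve (hurwitz (real (Suc X))) (hurwitz Y) \<beta> - convolve (hurwitz (real X)) (hurwitz Y) \<beta> =
        convolve (\<lambda>\<gamma>. hurwitz (real X + 1) \<gamma> - hurwitz (real X) \<gamma>) (hurwitz Y) \<beta>"
      by (simp add: convolve_diff_left add.commute)
    also have "(\<lambda>\<gamma>. hurwitz (real X + 1) \<gamma> - hurwitz (real X) \<gamma>) = shift (\<lambda>m \<gamma>. cbin m * hurwitz (real X + 1 + 2 * real m) \<gamma>)"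
      by (intro ext hurwitz_difference) simp
    also have "convolve \<dots> (hurwitz Y) \<beta> = shift (\<lambda>m. convolve (\<lambda>\<gamma>. cbin m * hurwitz (real X + 1 + 2 * real m) \<gamma>) (hurwitz Y)) \<beta>"
      by (rule convolve_shift_left)
    also have "\<dots> = shift (\<lambda>m \<gamma>. cbin m * hurwitz (real X + Y + 1 + 2 * real m) \<gamma>) \<beta>"
    proof (rule shift_cong)
      fix m \<gamma> assume \<beta>: "\<beta> = add_mset m \<gamma>"
      have "convolve (\<lambda>\<gamma>. cbin m * hurwitz (real X + 1 + 2 * real m) \<gamma>) (hurwitz Y) \<gamma> =
          cbin m * convolve (hurwitz (real (X + 1 + 2 * m))) (hurwitz Y) \<gamma>"
        using convolve_scale[of "cbin m" "hurwitz (real (X + 1 + 2 * m))" 1 "hurwitz Y" \<gamma>] by (simp add: algebra_simps)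
      \<comment> \<open>The first argument jumps up by 1 + 2m, so the outer induction on the size
        has to cover all natural arguments at once.\<close>
      also have "convolve (hurwitz (real (X + 1 + 2 * m))) (hurwitz Y) \<gamma> = hurwitz (real (X + 1 + 2 * m) + Y) \<gamma>"
        by (rule IH) (simp add: \<beta>)
      finally show "convolve (\<lambda>\<gamma>. cbin m * hurwitz (real X + 1 + 2 * real m) \<gamma>) (hurwitz Y) \<gamma> =
          cbin m * hurwitz (real X + Y + 1 + 2 * real m) \<gamma>"
        by (simp add: algebra_simps)
    qed
    also have "\<dots> = hurwitz (real X + Y + 1) \<beta> - hurwitz (real X + Y) \<beta>"
      using assms by (subst hurwitz_difference) auto
    finally show ?case using Suc by (simp add: algebra_simps)
  qed
qed

text \<open>The expected count without the factor \<open>real k * cbin k\<close> of the marked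
  cycle. Its rising product has one factor fewer than that of \<open>hurwitz\<close>, so it is no
  power of F.\<close>

definition hurwitz_shifted :: "nat \<Rightarrow> nat multiset \<Rightarrow> real" where
  "hurwitz_shifted k \<beta> = weight \<beta> * rising (2 * real k + 2 * real (sum_mset \<beta>) + 1) (int (size \<beta>) - 2)"

text \<open>The top factor of the rising product with |\<beta>| - 1 factors is 2k - 1 plus the sum
  of 2b + 1 over the parts b of \<beta>. The shift subtracts exactly this sum, one removed part at a
  time.\<close>

lemma hurwitz_shifted_eq:
  assumes "k \<ge> 1"
  shows "(2 * real k - 1) * hurwitz_shifted k \<beta> = hurwitz (2 * real k) \<beta> / (2 * real k) -
    shift (\<lambda>m \<gamma>. (2 * real m + 1) * cbin m * hurwitz (2 * real k + 2 * real m) \<gamma> / (2 * real k + 2 * real m)) \<beta>"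
proof -
  define S where "S = real (sum_mset \<beta>)"
  define r where "r = rising (2 * real k + 2 * S + 1)"
  have S: "S \<ge> 0" unfolding S_def by (rule of_nat_0_le_iff)
  have h: "hurwitz (2 * real k) \<beta> / (2 * real k) = weight \<beta> * r (int (size \<beta>) - 1)"
    using assms by (subst hurwitz_rising) (auto simp: r_def S_def)
  have "shift (\<lambda>m \<gamma>. (2 * real m + 1) * cbin m * hurwitz (2 * real k + 2 * real m) \<gamma> / (2 * real k + 2 * real m)) \<beta> =
     weight \<beta> * (\<Sum>m\<in>#\<beta>. r (int (size \<beta>) - 2) * (1 + 2 * real m))"
  proof (rule shift_weight)
    fix m \<gamma> assume \<beta>: "\<beta> = add_mset m \<gamma>"
    have *: "2 * real k + 2 * real m + 2 * real (sum_mset \<gamma>) + 1 = 2 * real k + 2 * S + 1" "int (size \<gamma>) - 1 = int (size \<beta>) - 2"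
      by (auto simp: S_def \<beta>)
    have h: "hurwitz (2 * real k + 2 * real m) \<gamma> / (2 * real k + 2 * real m) = weight \<gamma> * r (int (size \<beta>) - 2)"
      using assms by (subst hurwitz_rising) (simp_all add: r_def * del: of_nat_sum_mset)
    show "(2 * real m + 1) * cbin m * hurwitz (2 * real k + 2 * real m) \<gamma> / (2 * real k + 2 * real m) =
        cbin m * weight \<gamma> * (r (int (size \<beta>) - 2) * (1 + 2 * real m))"
      unfolding times_divide_eq_right[symmetric] h by simp
  qed
  also have "(\<Sum>m\<in>#\<beta>. r (int (size \<beta>) - 2) * (1 + 2 * real m)) = r (int (size \<beta>) - 2) * (real (size \<beta>) + 2 * S)"
    by (simp only: sum_mset_distrib_left[symmetric] sum_mset_const_add S_def mult_1_right)
  finally have s: "shift (\<lambda>m \<gamma>. (2 * real m + 1) * cbin m * hurwitz (2 * real k + 2 * real m) \<gamma> / (2 * real k + 2 * real m)) \<beta> =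
     weight \<beta> * (r (int (size \<beta>) - 2) * (real (size \<beta>) + 2 * S))" .
  have "r (int (size \<beta>) - 1) = (2 * real k + 2 * S + 1 + of_int (int (size \<beta>) - 1) - 1) * r (int (size \<beta>) - 1 - 1)"
    unfolding r_def using assms S by (intro rising_step) auto
  then have r: "r (int (size \<beta>) - 1) = (2 * real k + 2 * S - 1 + real (size \<beta>)) * r (int (size \<beta>) - 2)"
    by simp
  show ?thesis unfolding h s r by (simp add: hurwitz_shifted_def r_def S_def algebra_simps)
qed

subsection \<open>The recursion satisfied by the explicit formula\<close>

text \<open>This and \<open>cbin_conv2\<close> are the sums over i left after the
  \<open>hurwitz\<close> convolutions collapse: the central binomials are the prefactors in
  \<open>rooted_number_eq_factor\<close>, the denominators those of
  \<open>rooted_number_factor\<close>.\<close>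

definition cbin_conv :: "nat \<Rightarrow> nat \<Rightarrow> real" where
  "cbin_conv k a = (\<Sum>i\<in>{1..<k}. cbin (i - 1) * cbin (k - i - 1) / (real i + real a))"

definition cbin_conv2 :: "nat \<Rightarrow> nat \<Rightarrow> nat \<Rightarrow> real" where
  "cbin_conv2 k a b = (\<Sum>i\<in>{1..<k}. cbin (i - 1) * cbin (k - i - 1) / ((real i + real a) * (real (k - i) + real b)))"

lemma cbin_conv_eq:
  assumes "k \<ge> 2"
  shows "2 * (2 * real a + 1) * cbin a * cbin_conv k a = cbin (k + a - 1)"
proof -
  have "cbin_conv k a = (\<Sum>j\<le>k - 2. cbin j * cbin (k - 2 - j) / (real j + 1 + real a))"
    unfolding cbin_conv_def
    by (rule sum.reindex_bij_witness[where i = Suc and j = "\<lambda>i. i - 1"])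
       (use assms in \<open>auto simp: of_nat_diff algebra_simps numeral_2_eq_2\<close>)
  moreover have "k - 2 + a + 1 = k + a - 1" using assms by simp
  ultimately show ?thesis using cbin_convolution[of a "k - 2"] by presburger
qed

text \<open>Partial fractions: 1 / (x y) = (1 / x + 1 / y) / (x + y) for x = i + a and y = k - i +
  b, whose sum does not depend on i.\<close>

lemma cbin_conv2_eq:
  assumes "k \<ge> 1"
  shows "(real k + real a + real b) * cbin_conv2 k a b = cbin_conv k a + cbin_conv k b"
proof -
  have "cbin_conv k b = (\<Sum>i\<in>{1..<k}. cbin (i - 1) * cbin (k - i - 1) / (real (k - i) + real b))"
    unfolding cbin_conv_def
    by (rule sum.reindex_bij_witness[where i = "\<lambda>i. k - i" and j = "\<lambda>i. k - i"]) auto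
  then have "cbin_conv k a + cbin_conv k b = (\<Sum>i\<in>{1..<k}. cbin (i - 1) * cbin (k - i - 1) / (real i + real a) + cbin (i - 1) * cbin (k - i - 1) / (real (k - i) + real b))"
    by (simp add: cbin_conv_def sum.distrib)
  also have "\<dots> = (real k + real a + real b) * cbin_conv2 k a b"
    unfolding cbin_conv2_def sum_distrib_left
  proof (rule sum.cong)
    fix i assume i: "i \<in> {1..<k}"
    define x where "x = real i + real a"
    define y where "y = real (k - i) + real b"
    have "x > 0" "y > 0" "real k + real a + real b = x + y" using i by (auto simp: x_def y_def of_nat_diff)
    then show "cbin (i - 1) * cbin (k - i - 1) / (real i + real a) + cbin (i - 1) * cbin (k - i - 1) / (real (k - i) + real b) =
         (real k + real a + real b) * (cbin (i - 1) * cbin (k - i - 1) / ((real i + real a) * (real (k - i) + real b)))"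
      unfolding x_def[symmetric] y_def[symmetric] by (simp add: field_simps)
  qed simp
  finally show ?thesis by simp
qed

lemma cbin_conv2_commute: "cbin_conv2 k a b = cbin_conv2 k b a"
  unfolding cbin_conv2_def
  by (rule sum.reindex_bij_witness[where i = "\<lambda>i. k - i" and j = "\<lambda>i. k - i"]) (auto simp: mult.commute)

text \<open>
  The number of genus zero factorizations on \<open>d\<close> points in which the largest point lies in a cycle of
  length \<open>k\<close> and the other cycles have lengths \<open>\<beta>\<close>, divided by \<open>(d - 1)!\<close>.
\<close>

definition rooted_number :: "nat \<Rightarrow> nat multiset \<Rightarrow> real" where
  "rooted_number k \<beta> = real k * cbin k * hurwitz_shifted k \<beta>"

text \<open>With \<open>cbin (k - 1)\<close> divided out, k enters only through the
  \<open>hurwitz\<close> arguments and the denominators k + m, with m = 0 in the first term.\<close>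

definition rooted_number_factor :: "nat \<Rightarrow> nat multiset \<Rightarrow> real" where
  "rooted_number_factor k \<beta> = 1 / real k * hurwitz (2 * real k) \<beta> -
    shift (\<lambda>m \<gamma>. (2 * real m + 1) * cbin m / (real k + real m) * hurwitz (2 * real k + 2 * real m) \<gamma>) \<beta>"

lemma cbin_pred: "k \<ge> 1 \<Longrightarrow> real k * cbin k = 2 * (2 * real k - 1) * cbin (k - 1)"
  using cbin_Suc[of "k - 1"] by (simp add: of_nat_diff)

lemma shift_scale: "a * shift u \<beta> = shift (\<lambda>m \<gamma>. a * u m \<gamma>) \<beta>"
  by (simp add: shift_def sum_distrib_left)

lemma rooted_number_eq_factor:
  assumes "k \<ge> 1"
  shows "rooted_number k \<beta> = cbin (k - 1) * rooted_number_factor k \<beta>"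
proof -
  have "rooted_number k \<beta> = 2 * cbin (k - 1) * ((2 * real k - 1) * hurwitz_shifted k \<beta>)"
    using cbin_pred[OF assms] by (simp add: rooted_number_def)
  also have "\<dots> = cbin (k - 1) * (2 * (hurwitz (2 * real k) \<beta> / (2 * real k)) -
     2 * shift (\<lambda>m \<gamma>. (2 * real m + 1) * cbin m * hurwitz (2 * real k + 2 * real m) \<gamma> / (2 * real k + 2 * real m)) \<beta>)"
    unfolding hurwitz_shifted_eq[OF assms] by (simp add: algebra_simps)
  also have "2 * shift (\<lambda>m \<gamma>. (2 * real m + 1) * cbin m * hurwitz (2 * real k + 2 * real m) \<gamma> / (2 * real k + 2 * real m)) \<beta> =
     shift (\<lambda>m \<gamma>. (2 * real m + 1) * cbin m / (real k + real m) * hurwitz (2 * real k + 2 * real m) \<gamma>) \<beta>"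
    unfolding shift_scale
  proof (rule shift_cong)
    fix m \<gamma>
    have *: "2 * x / (2 * real k + 2 * real m) = x / (real k + real m)" for x :: real
      by (simp add: distrib_left[symmetric] del: distrib_left_numeral)
    show "2 * ((2 * real m + 1) * cbin m * hurwitz (2 * real k + 2 * real m) \<gamma> / (2 * real k + 2 * real m)) =
        (2 * real m + 1) * cbin m / (real k + real m) * hurwitz (2 * real k + 2 * real m) \<gamma>"
      unfolding times_divide_eq_right * by simp
  qed
  finally show ?thesis by (simp add: rooted_number_factor_def)
qed

lemma convolve_hurwitz_scale:
  assumes "k = i + j"
  shows "convolve (\<lambda>\<gamma>. a * hurwitz (2 * real i) \<gamma>) (\<lambda>\<gamma>. b * hurwitz (2 * real j) \<gamma>) \<beta> = a * b * hurwitz (2 * real k) \<beta>"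
  using hurwitz_convolution[of "2 * real j" "2 * i" \<beta>] assms by (simp add: convolve_scale algebra_simps)

text \<open>Multiply out two differences: in each of the four products the \<open>hurwitz\<close>
  arguments add up, and 2i + 2j = 2k, so i and j survive only in the coefficients
  \<open>q\<close>.\<close>

lemma convolve_rooted_number_factor:
  assumes k: "k = i + j" and q: "\<And>a b. q a b = 1 / (real i + real a) * (1 / (real j + real b))"
  shows "convolve (rooted_number_factor i) (rooted_number_factor j) \<beta> = q 0 0 * hurwitz (2 * real k) \<beta>
    - shift (\<lambda>m \<gamma>. (2 * real m + 1) * cbin m *
        (q 0 m + q m 0) * hurwitz (2 * real k + 2 * real m) \<gamma>) \<beta>
    + shift (\<lambda>m. shift (\<lambda>m' \<gamma>. (2 * real m + 1) * cbin m * ((2 * real m' + 1) * cbin m') *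
        q m m' * hurwitz (2 * real k + 2 * real m + 2 * real m') \<gamma>)) \<beta>"
proof -
  define u where "u i m \<gamma> = (2 * real m + 1) * cbin m / (real i + real m) * hurwitz (2 * real i + 2 * real m) \<gamma>" for i m :: nat and \<gamma>
  have u_eq: "u i = (\<lambda>m \<gamma>. (2 * real m + 1) * cbin m / (real i + real m) * hurwitz (2 * real i + 2 * real m) \<gamma>)" for i
    by (intro ext) (simp add: u_def)
  have nf: "rooted_number_factor i = (\<lambda>\<beta>. 1 / real i * hurwitz (2 * real i) \<beta> - shift (u i) \<beta>)" for i
    by (intro ext) (simp add: rooted_number_factor_def u_eq)
  have "convolve (rooted_number_factor i) (rooted_number_factor j) \<beta> =
     convolve (\<lambda>\<gamma>. 1 / real i * hurwitz (2 * real i) \<gamma>) (\<lambda>\<gamma>. 1 / real j * hurwitz (2 * real j) \<gamma>) \<beta>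
     - (convolve (\<lambda>\<gamma>. 1 / real i * hurwitz (2 * real i) \<gamma>) (shift (u j)) \<beta>
        + convolve (shift (u i)) (\<lambda>\<gamma>. 1 / real j * hurwitz (2 * real j) \<gamma>) \<beta>)
     + convolve (shift (u i)) (shift (u j)) \<beta>"
    unfolding nf convolve_diff_left convolve_diff_right by simp
  also have "convolve (\<lambda>\<gamma>. 1 / real i * hurwitz (2 * real i) \<gamma>) (\<lambda>\<gamma>. 1 / real j * hurwitz (2 * real j) \<gamma>) \<beta> =
      q 0 0 * hurwitz (2 * real k) \<beta>"
    by (simp only: q of_nat_0 add_0_right convolve_hurwitz_scale[OF k])
  also have "convolve (\<lambda>\<gamma>. 1 / real i * hurwitz (2 * real i) \<gamma>) (shift (u j)) \<beta>
        + convolve (shift (u i)) (\<lambda>\<gamma>. 1 / real j * hurwitz (2 * real j) \<gamma>) \<beta> =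
      shift (\<lambda>m \<gamma>. convolve (\<lambda>\<gamma>. 1 / real i * hurwitz (2 * real i) \<gamma>) (u j m) \<gamma> +
         convolve (u i m) (\<lambda>\<gamma>. 1 / real j * hurwitz (2 * real j) \<gamma>) \<gamma>) \<beta>"
    unfolding convolve_shift_left convolve_shift_right by (simp add: shift_def sum.distrib)
  also have "\<dots> = shift (\<lambda>m \<gamma>. (2 * real m + 1) * cbin m *
        (q 0 m + q m 0) * hurwitz (2 * real k + 2 * real m) \<gamma>) \<beta>"
  proof (rule shift_cong)
    fix m \<gamma>
    have alg: "p * (e / y) * h + e / x * s * h = e * (p * (1 / y) + 1 / x * s) * h" for p e x y h s :: real
      by (simp add: algebra_simps)
    have u: "u i m = (\<lambda>\<gamma>. ((2 * real m + 1) * cbin m / (real i + real m)) * hurwitz (2 * real (i + m)) \<gamma>)" for i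
      by (auto simp: u_def fun_eq_iff)
    have "convolve (\<lambda>\<gamma>. 1 / real i * hurwitz (2 * real i) \<gamma>) (u j m) \<gamma> =
        1 / real i * ((2 * real m + 1) * cbin m / (real j + real m)) * hurwitz (2 * real (k + m)) \<gamma>"
      unfolding u by (rule convolve_hurwitz_scale) (use k in simp)
    moreover have "convolve (u i m) (\<lambda>\<gamma>. 1 / real j * hurwitz (2 * real j) \<gamma>) \<gamma> =
        (2 * real m + 1) * cbin m / (real i + real m) * (1 / real j) * hurwitz (2 * real (k + m)) \<gamma>"
      unfolding u by (rule convolve_hurwitz_scale) (use k in simp)
    ultimately show "convolve (\<lambda>\<gamma>. 1 / real i * hurwitz (2 * real i) \<gamma>) (u j m) \<gamma> +
        convolve (u i m) (\<lambda>\<gamma>. 1 / real j * hurwitz (2 * real j) \<gamma>) \<gamma> = (2 * real m + 1) * cbin m *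
        (q 0 m + q m 0) * hurwitz (2 * real k + 2 * real m) \<gamma>"
      by (simp only: alg q of_nat_0 add_0_right of_nat_add distrib_left)
  qed
  also have "convolve (shift (u i)) (shift (u j)) \<beta> = shift (\<lambda>m. shift (\<lambda>m' \<gamma>. (2 * real m + 1) * cbin m * ((2 * real m' + 1) * cbin m') *
        q m m' * hurwitz (2 * real k + 2 * real m + 2 * real m') \<gamma>)) \<beta>"
    unfolding convolve_shift_left
  proof (rule shift_cong)
    fix m \<gamma>
    show "convolve (u i m) (shift (u j)) \<gamma> = shift (\<lambda>m' \<gamma>. (2 * real m + 1) * cbin m * ((2 * real m' + 1) * cbin m') *
        q m m' * hurwitz (2 * real k + 2 * real m + 2 * real m') \<gamma>) \<gamma>"
      unfolding convolve_shift_right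
    proof (rule shift_cong)
      fix m' \<gamma>
      have u: "u i m = (\<lambda>\<gamma>. ((2 * real m + 1) * cbin m / (real i + real m)) * hurwitz (2 * real (i + m)) \<gamma>)" for i m
        by (auto simp: u_def fun_eq_iff)
      have "convolve (u i m) (u j m') \<gamma> = (2 * real m + 1) * cbin m / (real i + real m) *
          ((2 * real m' + 1) * cbin m' / (real j + real m')) * hurwitz (2 * real (k + m + m')) \<gamma>"
        unfolding u by (rule convolve_hurwitz_scale) (use k in simp)
      then show "convolve (u i m) (u j m') \<gamma> = (2 * real m + 1) * cbin m * ((2 * real m' + 1) * cbin m') *
        q m m' * hurwitz (2 * real k + 2 * real m + 2 * real m') \<gamma>"
        by (simp add: q distrib_left mult.assoc del: mult.assoc)
    qed
  qed
  finally show ?thesis .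
qed

lemma shift_sum: "(\<Sum>i\<in>I. shift (u i) \<beta>) = shift (\<lambda>m \<gamma>. \<Sum>i\<in>I. u i m \<gamma>) \<beta>"
  unfolding shift_def by (rule sum.swap)

lemma sum_convolve_rooted_number:
  \<comment> \<open>Only coefficients depend on i, so the sum over i moves inside the shifts. The
    two mixed terms agree under the exchange of i and k - i.\<close>
  "(\<Sum>i\<in>{1..<k}. convolve (rooted_number i) (rooted_number (k - i)) \<beta>) =
    hurwitz (2 * real k) \<beta> * cbin_conv2 k 0 0
    - shift (\<lambda>m \<gamma>. (2 * real m + 1) * cbin m * hurwitz (2 * real k + 2 * real m) \<gamma> * (2 * cbin_conv2 k 0 m)) \<beta>
    + shift (\<lambda>m. shift (\<lambda>m' \<gamma>. (2 * real m + 1) * cbin m * ((2 * real m' + 1) * cbin m') *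
        hurwitz (2 * real k + 2 * real m + 2 * real m') \<gamma> * cbin_conv2 k m m')) \<beta>"
proof -
  define w where "w i = cbin (i - 1) * cbin (k - i - 1)" for i
  define q where "q i a b = 1 / (real i + real a) * (1 / (real (k - i) + real b))" for i a b :: nat
  have q: "cbin_conv2 k a b = (\<Sum>i\<in>{1..<k}. w i * q i a b)" for a b
    by (simp add: cbin_conv2_def w_def q_def)
  have "(\<Sum>i\<in>{1..<k}. convolve (rooted_number i) (rooted_number (k - i)) \<beta>) = (\<Sum>i\<in>{1..<k}. w i * convolve (rooted_number_factor i) (rooted_number_factor (k - i)) \<beta>)"
  proof (rule sum.cong)
    fix i assume i: "i \<in> {1..<k}"
    have "convolve (rooted_number i) (rooted_number (k - i)) \<beta> = convolve (\<lambda>\<gamma>. cbin (i - 1) * rooted_number_factor i \<gamma>) (\<lambda>\<gamma>. cbin (k - i - 1) * rooted_number_factor (k - i) \<gamma>) \<beta>"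
      unfolding convolve_def using i by (intro sum.cong refl arg_cong2[where f = "(*)"] rooted_number_eq_factor) auto
    then show "convolve (rooted_number i) (rooted_number (k - i)) \<beta> = w i * convolve (rooted_number_factor i) (rooted_number_factor (k - i)) \<beta>"
      by (simp add: convolve_scale w_def)
  qed simp
  also have "\<dots> = (\<Sum>i\<in>{1..<k}. hurwitz (2 * real k) \<beta> * (w i * q i 0 0)
     - shift (\<lambda>m \<gamma>. (2 * real m + 1) * cbin m * hurwitz (2 * real k + 2 * real m) \<gamma> * (w i * q i 0 m + w i * q i m 0)) \<beta>
     + shift (\<lambda>m. shift (\<lambda>m' \<gamma>. (2 * real m + 1) * cbin m * ((2 * real m' + 1) * cbin m') *
        hurwitz (2 * real k + 2 * real m + 2 * real m') \<gamma> * (w i * q i m m'))) \<beta>)"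
  proof (rule sum.cong)
    fix i assume i: "i \<in> {1..<k}"
    have "k = i + (k - i)" using i by simp
    from convolve_rooted_number_factor[OF this q_def]
    show "w i * convolve (rooted_number_factor i) (rooted_number_factor (k - i)) \<beta> = hurwitz (2 * real k) \<beta> * (w i * q i 0 0)
     - shift (\<lambda>m \<gamma>. (2 * real m + 1) * cbin m * hurwitz (2 * real k + 2 * real m) \<gamma> * (w i * q i 0 m + w i * q i m 0)) \<beta>
     + shift (\<lambda>m. shift (\<lambda>m' \<gamma>. (2 * real m + 1) * cbin m * ((2 * real m' + 1) * cbin m') *
        hurwitz (2 * real k + 2 * real m + 2 * real m') \<gamma> * (w i * q i m m'))) \<beta>"
      by (simp only: right_diff_distrib distrib_left shift_scale) (simp add: algebra_simps)
  qed simp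
  also have "\<dots> = hurwitz (2 * real k) \<beta> * cbin_conv2 k 0 0
    - shift (\<lambda>m \<gamma>. (2 * real m + 1) * cbin m * hurwitz (2 * real k + 2 * real m) \<gamma> * (cbin_conv2 k 0 m + cbin_conv2 k m 0)) \<beta>
    + shift (\<lambda>m. shift (\<lambda>m' \<gamma>. (2 * real m + 1) * cbin m * ((2 * real m' + 1) * cbin m') *
        hurwitz (2 * real k + 2 * real m + 2 * real m') \<gamma> * cbin_conv2 k m m')) \<beta>"
  proof -
    have "(\<Sum>i\<in>{1..<k}. hurwitz (2 * real k) \<beta> * (w i * q i 0 0)) = hurwitz (2 * real k) \<beta> * cbin_conv2 k 0 0"
      unfolding q by (rule sum_distrib_left[symmetric])
    moreover have "(\<Sum>i\<in>{1..<k}. shift (\<lambda>m \<gamma>. (2 * real m + 1) * cbin m * hurwitz (2 * real k + 2 * real m) \<gamma> * (w i * q i 0 m + w i * q i m 0)) \<beta>) =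
       shift (\<lambda>m \<gamma>. (2 * real m + 1) * cbin m * hurwitz (2 * real k + 2 * real m) \<gamma> * (cbin_conv2 k 0 m + cbin_conv2 k m 0)) \<beta>"
      unfolding q shift_sum sum.distrib[symmetric] sum_distrib_left[symmetric] ..
    moreover have "(\<Sum>i\<in>{1..<k}. shift (\<lambda>m. shift (\<lambda>m' \<gamma>. (2 * real m + 1) * cbin m * ((2 * real m' + 1) * cbin m') *
        hurwitz (2 * real k + 2 * real m + 2 * real m') \<gamma> * (w i * q i m m'))) \<beta>) =
      shift (\<lambda>m. shift (\<lambda>m' \<gamma>. (2 * real m + 1) * cbin m * ((2 * real m' + 1) * cbin m') *
        hurwitz (2 * real k + 2 * real m + 2 * real m') \<gamma> * cbin_conv2 k m m')) \<beta>"
      unfolding q shift_sum sum_distrib_left[symmetric] ..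
    moreover have "(\<Sum>i\<in>I. F i - G i + H i) = sum F I - sum G I + sum H I" for F G H :: "nat \<Rightarrow> real" and I
      by (simp add: sum.distrib sum_subtractf)
    ultimately show ?thesis by (simp only:)
  qed
  also have "shift (\<lambda>m \<gamma>. (2 * real m + 1) * cbin m * hurwitz (2 * real k + 2 * real m) \<gamma> * (cbin_conv2 k 0 m + cbin_conv2 k m 0)) \<beta> =
     shift (\<lambda>m \<gamma>. (2 * real m + 1) * cbin m * hurwitz (2 * real k + 2 * real m) \<gamma> * (2 * cbin_conv2 k 0 m)) \<beta>"
  proof (rule shift_cong)
    fix m \<gamma>
    show "(2 * real m + 1) * cbin m * hurwitz (2 * real k + 2 * real m) \<gamma> * (cbin_conv2 k 0 m + cbin_conv2 k m 0) =
      (2 * real m + 1) * cbin m * hurwitz (2 * real k + 2 * real m) \<gamma> * (2 * cbin_conv2 k 0 m)"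
      by (subst cbin_conv2_commute[of k m 0]) simp
  qed
  finally show ?thesis .
qed

text \<open>
  Written in terms of \<open>hurwitz\<close>, every convolution collapses by \<open>hurwitz_convolution\<close>; the remaining sums over
  \<open>i\<close> are evaluated by \<open>cbin_conv2_eq\<close> and \<open>cbin_conv_eq\<close>.
\<close>

theorem rooted_number_recursion:
  assumes k: "k \<ge> 1" and ne: "k \<noteq> 1 \<or> \<beta> \<noteq> {#}"
  shows "rooted_number k \<beta> = shift (\<lambda>m. rooted_number (k + m)) \<beta> + (\<Sum>i\<in>{1..<k}. convolve (rooted_number i) (rooted_number (k - i)) \<beta>)"
proof -
  define S where "S = real (sum_mset \<beta>)"
  define n where "n = int (size \<beta>)"
  define r where "r = rising (2 * real k + 2 * S + 1)"
  define U where "U = (\<Sum>m\<in>#\<beta>. 2 * real m + 1)"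
  have S: "S \<ge> 0" unfolding S_def by (rule of_nat_0_le_iff)
  have U: "U = real_of_int n + 2 * S"
    unfolding U_def n_def S_def using sum_mset_const_add[of 1 \<beta>] by (simp add: add.commute)
  \<comment> \<open>This fails exactly for k = 1 and \<beta> = {#}, the single point from which the
    recursion starts.\<close>
  have pos: "2 * real k + U - 2 > 0"
  proof (cases "k = 1")
    case True
    then have "n \<ge> 1" using ne by (simp add: n_def nonempty_has_size Suc_leI)
    then have "real_of_int n \<ge> 1" by simp
    then show ?thesis using True S by (simp add: U)
  qed (use k S in \<open>simp add: U n_def\<close>)
  have r1: "r (n - 1) = (2 * real k + U - 1) * r (n - 2)"
    unfolding r_def using rising_step[of "2 * real k + 2 * S + 1" "n - 1"] pos by (simp add: U algebra_simps)
  have r2: "r (n - 2) = (2 * real k + U - 2) * r (n - 3)"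
    unfolding r_def using rising_step[of "2 * real k + 2 * S + 1" "n - 2"] pos by (simp add: U algebra_simps)
  have rooted_number: "rooted_number k \<beta> = real k * cbin k * (weight \<beta> * r (n - 2))"
    by (simp add: rooted_number_def hurwitz_shifted_def r_def S_def n_def)
  have npt': "rooted_number (k + m) \<gamma> = real (k + m) * cbin (k + m) * (weight \<gamma> * r (n - 3))" if "\<beta> = add_mset m \<gamma>" for m \<gamma>
    using that by (simp add: rooted_number_def hurwitz_shifted_def r_def S_def n_def algebra_simps)
  show ?thesis
  proof (cases "k = 1")
    case True
    \<comment> \<open>For k = 1 there is no split; the cuts alone supply the factor
      \<open>U\<close>, which for k = 1 is the ratio in \<open>r2\<close>.\<close>
    have "shift (\<lambda>m. rooted_number (k + m)) \<beta> = weight \<beta> * (\<Sum>m\<in>#\<beta>. 2 * r (n - 3) * (2 * real m + 1))"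
    proof (rule shift_weight)
      fix m \<gamma> assume \<beta>: "\<beta> = add_mset m \<gamma>"
      have "real (k + m) * cbin (k + m) = 2 * (2 * real m + 1) * cbin m"
        using cbin_Suc[of m] True by simp
      then show "rooted_number (k + m) \<gamma> = cbin m * weight \<gamma> * (2 * r (n - 3) * (2 * real m + 1))"
        unfolding npt'[OF \<beta>] by (simp add: algebra_simps)
    qed
    also have "(\<Sum>m\<in>#\<beta>. 2 * r (n - 3) * (2 * real m + 1)) = 2 * r (n - 3) * U"
      by (simp only: sum_mset_distrib_left[symmetric] U_def)
    finally show ?thesis
      unfolding rooted_number r2 using True by (simp add: cbin_def)
  next
    case False
    then have k2: "k \<ge> 2" using k by simp
    \<comment> \<open>By \<open>cbin_conv_eq\<close>, \<open>R m\<close> equals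
      \<open>cbin (k + m - 1) / (2 * (2 * m + 1) * cbin m)\<close>; so the cut terms can be written
      in the same sums as the split terms.\<close>
    define R where "R = cbin_conv k"
    define V where "V = (\<Sum>m\<in>#\<beta>. (2 * real m + 1) * R m)"
    define V2 where "V2 = (\<Sum>m\<in>#\<beta>. (2 * real m + 1)\<^sup>2 * R m)"
    have Q: "2 * (real k + real a + real b) * cbin_conv2 k a b = 2 * (R a + R b)" for a b
      unfolding mult.assoc cbin_conv2_eq[OF k, of a b] R_def ..
    have T1: "shift (\<lambda>m. rooted_number (k + m)) \<beta> = weight \<beta> * (4 * r (n - 3) * ((2 * real k - 2) * V + V2))"
    proof -
      have "shift (\<lambda>m. rooted_number (k + m)) \<beta> = weight \<beta> * (\<Sum>m\<in>#\<beta>. 4 * r (n - 3) * ((2 * real k - 2) * ((2 * real m + 1) * R m) + (2 * real m + 1)\<^sup>2 * R m))"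
      proof (rule shift_weight)
        fix m \<gamma> assume \<beta>: "\<beta> = add_mset m \<gamma>"
        have e: "real (k + m) * cbin (k + m) = 2 * (2 * real (k + m) - 1) * (2 * (2 * real m + 1) * cbin m * R m)"
          using cbin_pred[of "k + m"] cbin_conv_eq[OF k2, of m] k by (simp add: R_def)
        show "rooted_number (k + m) \<gamma> = cbin m * weight \<gamma> * (4 * r (n - 3) * ((2 * real k - 2) * ((2 * real m + 1) * R m) + (2 * real m + 1)\<^sup>2 * R m))"
          unfolding npt'[OF \<beta>] e by (simp add: algebra_simps power2_eq_square)
      qed
      then show ?thesis
        by (simp only: sum_mset_distrib_left[symmetric] sum_mset.distrib V_def V2_def)
    qed
    have A: "hurwitz (2 * real k) \<beta> * cbin_conv2 k 0 0 = weight \<beta> * (4 * R 0 * r (n - 1))"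
    proof -
      have "hurwitz (2 * real k) \<beta> = weight \<beta> * (2 * real k) * r (n - 1)"
        unfolding r_def S_def n_def using k by (intro hurwitz_rising) simp
      then show ?thesis using Q[of 0 0] by simp
    qed
    have B: "shift (\<lambda>m \<gamma>. (2 * real m + 1) * cbin m * hurwitz (2 * real k + 2 * real m) \<gamma> * (2 * cbin_conv2 k 0 m)) \<beta> =
        weight \<beta> * (4 * r (n - 2) * (R 0 * U + V))"
    proof -
      have "shift (\<lambda>m \<gamma>. (2 * real m + 1) * cbin m * hurwitz (2 * real k + 2 * real m) \<gamma> * (2 * cbin_conv2 k 0 m)) \<beta> =
        weight \<beta> * (\<Sum>m\<in>#\<beta>. 4 * r (n - 2) * (R 0 * (2 * real m + 1) + (2 * real m + 1) * R m))"
      proof (rule shift_weight)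
        fix m \<gamma> assume \<beta>: "\<beta> = add_mset m \<gamma>"
        have "2 * real k + 2 * real m + 2 * real (sum_mset \<gamma>) + 1 = 2 * real k + 2 * S + 1" "int (size \<gamma>) - 1 = n - 2"
          by (auto simp: S_def n_def \<beta>)
        then have "rising (2 * real k + 2 * real m + 2 * real (sum_mset \<gamma>) + 1) (int (size \<gamma>) - 1) = r (n - 2)"
          by (simp only: r_def)
        moreover have "hurwitz (2 * real k + 2 * real m) \<gamma> = weight \<gamma> * (2 * real k + 2 * real m) *
            rising (2 * real k + 2 * real m + 2 * real (sum_mset \<gamma>) + 1) (int (size \<gamma>) - 1)"
          using k by (intro hurwitz_rising) simp
        ultimately have "hurwitz (2 * real k + 2 * real m) \<gamma> = weight \<gamma> * (2 * (real k + real m)) * r (n - 2)"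
          by (simp only: distrib_left)
        then have "(2 * real m + 1) * cbin m * hurwitz (2 * real k + 2 * real m) \<gamma> * (2 * cbin_conv2 k 0 m) =
            (2 * real m + 1) * cbin m * weight \<gamma> * r (n - 2) * 2 * (2 * (real k + real 0 + real m) * cbin_conv2 k 0 m)"
          by simp
        then show "(2 * real m + 1) * cbin m * hurwitz (2 * real k + 2 * real m) \<gamma> * (2 * cbin_conv2 k 0 m) =
            cbin m * weight \<gamma> * (4 * r (n - 2) * (R 0 * (2 * real m + 1) + (2 * real m + 1) * R m))"
          unfolding Q by (simp add: algebra_simps)
      qed
      then show ?thesis
        by (simp only: sum_mset_distrib_left[symmetric] sum_mset.distrib V_def U_def)
    qed
    have C: "shift (\<lambda>m. shift (\<lambda>m' \<gamma>. (2 * real m + 1) * cbin m * ((2 * real m' + 1) * cbin m') *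
        hurwitz (2 * real k + 2 * real m + 2 * real m') \<gamma> * cbin_conv2 k m m')) \<beta> =
        weight \<beta> * (4 * r (n - 3) * (U * V - V2))"
    proof -
      have "shift (\<lambda>m. shift (\<lambda>m' \<gamma>. (2 * real m + 1) * cbin m * ((2 * real m' + 1) * cbin m') *
        hurwitz (2 * real k + 2 * real m + 2 * real m') \<gamma> * cbin_conv2 k m m')) \<beta> =
        weight \<beta> * (\<Sum>m\<in>#\<beta>. 2 * r (n - 3) * ((U * ((2 * real m + 1) * R m) + V * (2 * real m + 1)) + (-2) * ((2 * real m + 1)\<^sup>2 * R m)))"
      proof (rule shift_weight)
        fix m \<gamma> assume \<beta>: "\<beta> = add_mset m \<gamma>"
        have "shift (\<lambda>m' \<gamma>. (2 * real m + 1) * cbin m * ((2 * real m' + 1) * cbin m') *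
          hurwitz (2 * real k + 2 * real m + 2 * real m') \<gamma> * cbin_conv2 k m m') \<gamma> =
          weight \<gamma> * (\<Sum>m'\<in>#\<gamma>. (2 * real m + 1) * cbin m * 2 * r (n - 3) * (R m * (2 * real m' + 1) + (2 * real m' + 1) * R m'))"
        proof (rule shift_weight)
          fix m' \<delta> assume \<gamma>: "\<gamma> = add_mset m' \<delta>"
          have "2 * real k + 2 * real m + 2 * real m' + 2 * real (sum_mset \<delta>) + 1 = 2 * real k + 2 * S + 1" "int (size \<delta>) - 1 = n - 3"
            by (auto simp: S_def n_def \<beta> \<gamma>)
          then have "rising (2 * real k + 2 * real m + 2 * real m' + 2 * real (sum_mset \<delta>) + 1) (int (size \<delta>) - 1) = r (n - 3)"
            by (simp only: r_def)
          moreover have "hurwitz (2 * real k + 2 * real m + 2 * real m') \<delta> = weight \<delta> * (2 * real k + 2 * real m + 2 * real m') *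
              rising (2 * real k + 2 * real m + 2 * real m' + 2 * real (sum_mset \<delta>) + 1) (int (size \<delta>) - 1)"
            using k by (intro hurwitz_rising) simp
          ultimately have "hurwitz (2 * real k + 2 * real m + 2 * real m') \<delta> = weight \<delta> * (2 * (real k + real m + real m')) * r (n - 3)"
            by (simp only: distrib_left)
          then have "(2 * real m + 1) * cbin m * ((2 * real m' + 1) * cbin m') *
              hurwitz (2 * real k + 2 * real m + 2 * real m') \<delta> * cbin_conv2 k m m' =
              (2 * real m + 1) * cbin m * ((2 * real m' + 1) * cbin m') * weight \<delta> * r (n - 3) *
              (2 * (real k + real m + real m') * cbin_conv2 k m m')"
            by simp
          then show "(2 * real m + 1) * cbin m * ((2 * real m' + 1) * cbin m') *
              hurwitz (2 * real k + 2 * real m + 2 * real m') \<delta> * cbin_conv2 k m m' =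
              cbin m' * weight \<delta> * ((2 * real m + 1) * cbin m * 2 * r (n - 3) * (R m * (2 * real m' + 1) + (2 * real m' + 1) * R m'))"
            unfolding Q by (simp add: algebra_simps)
        qed
        also have "(\<Sum>m'\<in>#\<gamma>. (2 * real m + 1) * cbin m * 2 * r (n - 3) * (R m * (2 * real m' + 1) + (2 * real m' + 1) * R m')) =
            (2 * real m + 1) * cbin m * 2 * r (n - 3) * (R m * (\<Sum>m'\<in>#\<gamma>. 2 * real m' + 1) + (\<Sum>m'\<in>#\<gamma>. (2 * real m' + 1) * R m'))"
          by (simp only: sum_mset_distrib_left[symmetric] sum_mset.distrib)
        \<comment> \<open>The second part is taken from what the first one leaves. Excluding a part
          paired with itself is the source of \<open>V2\<close>.\<close>
        also have "(\<Sum>m'\<in>#\<gamma>. 2 * real m' + 1) = U - (2 * real m + 1)"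
          unfolding U_def \<beta> by simp
        also have "(\<Sum>m'\<in>#\<gamma>. (2 * real m' + 1) * R m') = V - (2 * real m + 1) * R m"
          unfolding V_def \<beta> by simp
        finally show "shift (\<lambda>m' \<gamma>. (2 * real m + 1) * cbin m * ((2 * real m' + 1) * cbin m') *
          hurwitz (2 * real k + 2 * real m + 2 * real m') \<gamma> * cbin_conv2 k m m') \<gamma> =
          cbin m * weight \<gamma> * (2 * r (n - 3) * ((U * ((2 * real m + 1) * R m) + V * (2 * real m + 1)) + (-2) * ((2 * real m + 1)\<^sup>2 * R m)))"
          by (simp add: algebra_simps power2_eq_square)
      qed
      also have "(\<Sum>m\<in>#\<beta>. 2 * r (n - 3) * ((U * ((2 * real m + 1) * R m) + V * (2 * real m + 1)) + (-2) * ((2 * real m + 1)\<^sup>2 * R m))) =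
         2 * r (n - 3) * ((U * V + V * U) + (-2) * V2)"
        unfolding U_def V_def V2_def by (simp only: sum_mset_distrib_left[symmetric] sum_mset.distrib)
      finally show ?thesis by (simp add: algebra_simps)
    qed
    have "real k * cbin k = 4 * (2 * real k - 1) * R 0"
    proof -
      have c: "cbin (k - 1) = 2 * R 0" using cbin_conv_eq[OF k2, of 0] by (simp add: R_def)
      show ?thesis unfolding cbin_pred[OF k] c by simp
    qed
    then have "rooted_number k \<beta> = weight \<beta> * (4 * (2 * real k - 1) * R 0 * r (n - 2))"
      unfolding rooted_number by simp
    also have "\<dots> = weight \<beta> * (4 * R 0 * r (n - 1) - 4 * R 0 * U * r (n - 2))"
      unfolding r1 by (simp add: algebra_simps)
    \<comment> \<open>\<open>V2\<close> cancels between the cuts and the double removals, and the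
      terms with \<open>V\<close> alone or \<open>U * V\<close> cancel by \<open>r2\<close>.\<close>
    also have "\<dots> = weight \<beta> * (4 * r (n - 3) * ((2 * real k - 2) * V + V2)) +
      (weight \<beta> * (4 * R 0 * r (n - 1)) - weight \<beta> * (4 * r (n - 2) * (R 0 * U + V)) + weight \<beta> * (4 * r (n - 3) * (U * V - V2)))"
      unfolding r1 r2 by (simp add: algebra_simps)
    finally show ?thesis
      unfolding sum_convolve_rooted_number A B C T1 .
  qed
qed

subsection \<open>Cutting and joining cycles\<close>

text \<open>\<open>cycle_type\<close> on an arbitrary ground set, since the pieces of a split do not
  live on initial segments.\<close>

definition ctype :: "(nat \<Rightarrow> nat) \<Rightarrow> nat set \<Rightarrow> nat multiset" where
  "ctype \<sigma> A = image_mset card (mset_set (orbit \<sigma> ` A))"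

definition other_cycles :: "(nat \<Rightarrow> nat) \<Rightarrow> nat set \<Rightarrow> nat \<Rightarrow> nat multiset" where
  "other_cycles \<sigma> A x = image_mset card (mset_set (orbit \<sigma> ` A - {orbit \<sigma> x}))"

lemma ctype_other_cycles: "finite A \<Longrightarrow> x \<in> A \<Longrightarrow> ctype \<sigma> A = add_mset (card (orbit \<sigma> x)) (other_cycles \<sigma> A x)"
  unfolding ctype_def other_cycles_def
  by (subst mset_set.remove[of _ "orbit \<sigma> x"]) auto

context
  fixes \<sigma> :: "nat \<Rightarrow> nat" and A :: "nat set"
  assumes perm: "\<sigma> permutes A" and fin: "finite A"
begin

lemma permutation_perm: "permutation \<sigma>"
  using perm fin permutation_permutes by blast

lemma self_orbit: "x \<in> orbit \<sigma> x"
  using permutation_perm by (rule permutation_self_in_orbit)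

lemma orbit_eq: "y \<in> orbit \<sigma> x \<Longrightarrow> orbit \<sigma> y = orbit \<sigma> x"
  by (rule orbit_cyclic_eq3[OF cyclic_on_orbit[OF perm fin]])

lemma orbit_eq_iff: "orbit \<sigma> y = orbit \<sigma> x \<longleftrightarrow> y \<in> orbit \<sigma> x"
  by (metis orbit_eq self_orbit)

lemma orbit_sub: "x \<in> A \<Longrightarrow> orbit \<sigma> x \<subseteq> A"
  by (rule permutes_orbit_subset[OF perm])

lemma orbits_disjoint: "orbit \<sigma> x \<noteq> orbit \<sigma> y \<Longrightarrow> orbit \<sigma> x \<inter> orbit \<sigma> y = {}"
  by (metis disjoint_iff orbit_eq)

lemma disjoint_orbits: "pairwise disjnt (orbit \<sigma> ` A)"
  by (auto simp only: pairwise_def disjnt_def ball_simps intro!: orbits_disjoint)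

lemma card_orbit_pos: "card (orbit \<sigma> x) > 0"
  using finite_orbit[OF self_orbit] self_orbit by (auto simp: card_gt_0_iff)

lemma orbit_enum:
  fixes x :: nat
  defines "k \<equiv> card (orbit \<sigma> x)"
  shows "inj_on (\<lambda>j. (\<sigma> ^^ j) x) {0..<k}" "(\<sigma> ^^ k) x = x" "orbit \<sigma> x = (\<lambda>j. (\<sigma> ^^ j) x) ` {0..<k}"
proof -
  define n where "n = funpow_dist1 \<sigma> x x"
  have inj: "inj_on (\<lambda>j. (\<sigma> ^^ j) x) {0..<n}"
    unfolding n_def by (rule inj_on_funpow_dist1[OF self_orbit])
  have orb: "orbit \<sigma> x = (\<lambda>j. (\<sigma> ^^ j) x) ` {0..<n}"
    unfolding n_def by (rule orbit_conv_funpow_dist1[OF self_orbit])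
  have "(\<sigma> ^^ n) x = x"
    unfolding n_def by (rule funpow_dist1_prop[OF self_orbit])
  moreover have "k = n" unfolding k_def orb using card_image[OF inj] by simp
  ultimately show "inj_on (\<lambda>j. (\<sigma> ^^ j) x) {0..<k}" "(\<sigma> ^^ k) x = x" "orbit \<sigma> x = (\<lambda>j. (\<sigma> ^^ j) x) ` {0..<k}"
    using inj orb by auto
qed

lemma sum_ctype: "sum_mset (ctype \<sigma> A) = card A"
proof -
  have "sum_mset (ctype \<sigma> A) = (\<Sum>C\<in>orbit \<sigma> ` A. card C)"
    by (simp add: ctype_def sum_unfold_sum_mset)
  also have "\<dots> = card (\<Union>(orbit \<sigma> ` A))"
    by (rule card_Union_disjoint[symmetric])
       (use disjoint_orbits in \<open>auto intro: finite_subset[OF orbit_sub fin] pairwise_subset\<close>)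
  also have "\<Union>(orbit \<sigma> ` A) = A"
    using orbit_sub self_orbit by auto
  finally show ?thesis .
qed

lemma card_orbit_other_cycles: "x \<in> A \<Longrightarrow> card A = card (orbit \<sigma> x) + sum_mset (other_cycles \<sigma> A x)"
  using sum_ctype ctype_other_cycles[OF fin, of x \<sigma>] by simp

lemma card_points_in_cycles: "card {a \<in> A. card (orbit \<sigma> a) = m} = m * count (ctype \<sigma> A) m"
proof -
  have "{a \<in> A. card (orbit \<sigma> a) = m} = \<Union>{C \<in> orbit \<sigma> ` A. card C = m}"
    using orbit_sub self_orbit orbit_eq by fastforce
  also have "card \<dots> = (\<Sum>C\<in>{C \<in> orbit \<sigma> ` A. card C = m}. card C)"
    by (rule card_Union_disjoint)
       (use disjoint_orbits in \<open>auto intro: finite_subset[OF orbit_sub fin] pairwise_subset\<close>)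
  also have "\<dots> = m * card {C \<in> orbit \<sigma> ` A. card C = m}" by simp
  also have "card {C \<in> orbit \<sigma> ` A. card C = m} = count (ctype \<sigma> A) m"
    using fin by (auto simp: ctype_def count_image_mset' intro!: arg_cong[where f = card])
  finally show ?thesis .
qed

lemma permutes_comp_transpose: "x \<in> A \<Longrightarrow> y \<in> A \<Longrightarrow> \<sigma> \<circ> transpose y x permutes A"
  by (rule permutes_compose[OF permutes_swap_id perm])

end

lemma orbit_subset_closed:
  assumes "f x \<in> S" "\<And>z. z \<in> S \<Longrightarrow> f z \<in> S"
  shows "orbit f x \<subseteq> S"
proof
  fix z assume "z \<in> orbit f x"
  then show "z \<in> S" by induction (use assms in auto)
qed

text \<open>The transposition acts first, so x goes to \<open>p (Suc i)\<close> and y to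
  \<open>p 1\<close>. Numbered as p 1, ..., p k with p k = x, the cycle falls into the intervals
  ending at p i = y and at p k = x.\<close>

lemma cut_cycle:
  assumes perm: "\<sigma> permutes A" and fin: "finite A" and x: "x \<in> A"
    and i: "0 < i" "i < card (orbit \<sigma> x)"
  defines "y \<equiv> (\<sigma> ^^ i) x"
  defines "\<tau> \<equiv> \<sigma> \<circ> Transposition.transpose y x"
  shows "y \<in> A" "y \<noteq> x" "y \<notin> orbit \<tau> x" "card (orbit \<tau> y) = i" "card (orbit \<tau> x) = card (orbit \<sigma> x) - i"
    "other_cycles \<tau> A x = add_mset i (other_cycles \<sigma> A x)"
proof -
  define k where "k = card (orbit \<sigma> x)"
  define p where "p j = (\<sigma> ^^ j) x" for j
  note en = orbit_enum[OF perm fin, of x, folded k_def p_def]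
  have p_Suc: "\<sigma> (p j) = p (Suc j)" for j by (simp add: p_def)
  have i': "i < k" using i by (simp add: k_def)
  have p0: "p 0 = x" by (simp add: p_def)
  have pi: "p i = y" by (simp add: p_def y_def)
  \<comment> \<open>Indices 1 to k instead of 0 to k - 1 make both new cycles intervals of
    indices.\<close>
  have inj: "inj_on p {1..k}"
  proof (rule inj_onI)
    fix a b assume ab: "a \<in> {1..k}" "b \<in> {1..k}" "p a = p b"
    have "inj \<sigma>" using perm permutes_inj by blast
    moreover have "\<sigma> (p (a - 1)) = \<sigma> (p (b - 1))" using ab by (simp add: p_Suc)
    ultimately have "p (a - 1) = p (b - 1)" by (rule injD)
    from inj_onD[OF en(1) this] have "a - 1 = b - 1" using ab by auto
    then show "a = b" using ab(1,2) unfolding atLeastAtMost_iff by arith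
  qed
  have orb: "orbit \<sigma> x = p ` {1..k}"
  proof -
    have "p ` {0..<k} = p ` {1..k}"
    proof (intro equalityI subsetI)
      fix z assume "z \<in> p ` {0..<k}"
      then obtain j where j: "j < k" "z = p j" by auto
      then show "z \<in> p ` {1..k}"
        using en(2) p0 by (cases "j = 0") (auto intro!: image_eqI[of _ _ "if j = 0 then k else j"])
    next
      fix z assume "z \<in> p ` {1..k}"
      then obtain j where j: "1 \<le> j" "j \<le> k" "z = p j" by auto
      then show "z \<in> p ` {0..<k}"
        using en(2) p0 i' by (cases "j = k") (auto intro!: image_eqI[of _ _ "if j = k then 0 else j"])
    qed
    then show ?thesis using en(3) by simp
  qed
  show yx: "y \<noteq> x"
    using inj_onD[OF en(1), of i 0] i i' p0 pi by auto
  show yA: "y \<in> A"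
    using orbit_sub[OF perm fin x] en(3) i' pi by auto
  have \<tau>x: "\<tau> x = p (Suc i)" and \<tau>y: "\<tau> y = p 1"
    using p_Suc[of i] p_Suc[of 0] by (auto simp: \<tau>_def p0 pi)
  have \<tau>p: "\<tau> (p j) = p (Suc j)" if "0 < j" "j < k" "j \<noteq> i" for j
  proof -
    have "p j \<noteq> p 0" "p j \<noteq> p i" using inj_onD[OF en(1), of j 0] inj_onD[OF en(1), of j i] that i' by auto
    then show ?thesis using p_Suc[of j] by (simp add: \<tau>_def p0 pi transpose_apply_other)
  qed
  have ox: "orbit \<tau> x = p ` {Suc i..k}"
  proof
    show "orbit \<tau> x \<subseteq> p ` {Suc i..k}"
    proof (rule orbit_subset_closed)
      fix z assume "z \<in> p ` {Suc i..k}"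
      then obtain j where j: "Suc i \<le> j" "j \<le> k" "z = p j" by auto
      then show "\<tau> z \<in> p ` {Suc i..k}"
        using \<tau>p[of j] \<tau>x en(2) i' by (cases "j = k") auto
    qed (use \<tau>x i' in auto)
    have "p j \<in> orbit \<tau> x" if "Suc i \<le> j" "j \<le> k" for j
      using that
    proof (induction j rule: dec_induct)
      case base
      then show ?case using orbit.base[of \<tau> x] by (simp add: \<tau>x)
    next
      case (step j)
      then have "\<tau> (p j) \<in> orbit \<tau> x" by (intro orbit.step) auto
      then show ?case using step \<tau>p[of j] by simp
    qed
    then show "p ` {Suc i..k} \<subseteq> orbit \<tau> x" by auto
  qed
  have oy: "orbit \<tau> y = p ` {1..i}"
  proof
    show "orbit \<tau> y \<subseteq> p ` {1..i}"
    proof (rule orbit_subset_closed)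
      fix z assume "z \<in> p ` {1..i}"
      then obtain j where j: "1 \<le> j" "j \<le> i" "z = p j" by auto
      then show "\<tau> z \<in> p ` {1..i}"
        using \<tau>p[of j] \<tau>y i i' pi by (cases "j = i") auto
    qed (use \<tau>y i in auto)
    have "p j \<in> orbit \<tau> y" if "1 \<le> j" "j \<le> i" for j
      using that
    proof (induction j rule: dec_induct)
      case base
      then show ?case using orbit.base[of \<tau> y] by (simp add: \<tau>y)
    next
      case (step j)
      then have "\<tau> (p j) \<in> orbit \<tau> y" by (intro orbit.step) auto
      then show ?case using step \<tau>p[of j] i' by simp
    qed
    then show "p ` {1..i} \<subseteq> orbit \<tau> y" by auto
  qed
  have dis: "p ` {1..i} \<inter> p ` {Suc i..k} = {}"
    using i' by (subst inj_on_image_Int[OF inj, symmetric]) auto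
  have un: "orbit \<sigma> x = orbit \<tau> x \<union> orbit \<tau> y"
    unfolding orb ox oy image_Un[symmetric] using i i' by (intro arg_cong[where f = "image p"]) auto
  have "inj_on p {Suc i..k}" "inj_on p {1..i}"
    by (rule inj_on_subset[OF inj], use i' in auto)+
  then show cx: "card (orbit \<tau> x) = card (orbit \<sigma> x) - i" and cy: "card (orbit \<tau> y) = i"
    unfolding ox oy by (auto simp: card_image k_def[symmetric])
  have perm': "\<tau> permutes A"
    unfolding \<tau>_def by (rule permutes_comp_transpose[OF perm fin x yA])
  have "y \<in> orbit \<tau> y" by (rule self_orbit[OF perm' fin])
  then show y: "y \<notin> orbit \<tau> x" using dis unfolding ox oy by auto
  have other: "orbit \<tau> z = orbit \<sigma> z" if "z \<notin> orbit \<sigma> x" for z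
  proof (rule orbit_cong)
    show "z \<in> orbit \<sigma> z" by (rule self_orbit[OF perm fin])
    fix s assume s: "s \<in> orbit \<sigma> z"
    have "y \<in> orbit \<sigma> x" "x \<in> orbit \<sigma> x" using un \<open>y \<in> orbit \<tau> y\<close> self_orbit[OF perm fin] by auto
    then have "s \<noteq> x" "s \<noteq> y"
      using s that orbit_eq[OF perm fin] by (metis self_orbit[OF perm fin])+
    then show "\<tau> s = \<sigma> s" by (simp add: \<tau>_def transpose_apply_other)
  qed
  have eq: "orbit \<tau> ` A - {orbit \<tau> x} = insert (orbit \<tau> y) (orbit \<sigma> ` A - {orbit \<sigma> x})"
  proof (intro equalityI subsetI)
    fix C assume "C \<in> orbit \<tau> ` A - {orbit \<tau> x}"
    then obtain z where z: "z \<in> A" "C = orbit \<tau> z" "orbit \<tau> z \<noteq> orbit \<tau> x" by auto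
    show "C \<in> insert (orbit \<tau> y) (orbit \<sigma> ` A - {orbit \<sigma> x})"
    proof (cases "z \<in> orbit \<sigma> x")
      case True
      then have "z \<in> orbit \<tau> y" using z un orbit_eq[OF perm' fin] by auto
      then show ?thesis using z orbit_eq[OF perm' fin] by auto
    next
      case False
      then show ?thesis using z other[OF False] orbit_eq_iff[OF perm fin] by auto
    qed
  next
    fix C assume "C \<in> insert (orbit \<tau> y) (orbit \<sigma> ` A - {orbit \<sigma> x})"
    then consider "C = orbit \<tau> y" | z where "z \<in> A" "C = orbit \<sigma> z" "orbit \<sigma> z \<noteq> orbit \<sigma> x" by auto
    then show "C \<in> orbit \<tau> ` A - {orbit \<tau> x}"
    proof cases
      case 1
      then show ?thesis using y yA \<open>y \<in> orbit \<tau> y\<close> by auto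
    next
      case 2
      then have nz: "z \<notin> orbit \<sigma> x" using orbit_eq_iff[OF perm fin] by auto
      then have "z \<notin> orbit \<tau> x" using un by auto
      then show ?thesis using 2 other[OF nz] self_orbit[OF perm' fin, of z] by auto
    qed
  qed
  have "orbit \<tau> y \<notin> orbit \<sigma> ` A - {orbit \<sigma> x}"
  proof
    assume "orbit \<tau> y \<in> orbit \<sigma> ` A - {orbit \<sigma> x}"
    then obtain z where "orbit \<tau> y = orbit \<sigma> z" "orbit \<sigma> z \<noteq> orbit \<sigma> x" by auto
    moreover have "y \<in> orbit \<sigma> x" using un \<open>y \<in> orbit \<tau> y\<close> by auto
    ultimately show False using \<open>y \<in> orbit \<tau> y\<close> orbits_disjoint[OF perm fin, of z x] by auto
  qed
  then show "other_cycles \<tau> A x = add_mset i (other_cycles \<sigma> A x)"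
    using fin cy by (simp add: other_cycles_def eq)
qed

text \<open>If the \<tau>-orbit of x missed y, then \<tau> would agree with \<sigma> along the
  \<sigma>-cycle of y. Starting at \<tau> x = \<sigma> y, it would follow that cycle all the way
  round to y.\<close>

lemma transpose_joins:
  fixes \<sigma> :: "nat \<Rightarrow> nat"
  assumes perm: "\<sigma> permutes A" and fin: "finite A" and y: "y \<notin> orbit \<sigma> x"
  shows "y \<in> orbit (\<sigma> \<circ> Transposition.transpose y x) x"
proof (rule ccontr)
  define \<tau> where "\<tau> = \<sigma> \<circ> Transposition.transpose y x"
  assume "y \<notin> orbit (\<sigma> \<circ> Transposition.transpose y x) x"
  then have ny: "y \<notin> orbit \<tau> x" by (simp add: \<tau>_def)
  have x: "x \<notin> orbit \<sigma> y"
    using y orbit_eq_iff[OF perm fin] self_orbit[OF perm fin] by metis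
  have \<tau>x: "\<tau> x = \<sigma> y" by (simp add: \<tau>_def)
  have "orbit \<sigma> y \<subseteq> orbit \<tau> x \<inter> orbit \<sigma> y"
  proof (rule orbit_subset_closed)
    show "\<sigma> y \<in> orbit \<tau> x \<inter> orbit \<sigma> y"
      using orbit.base[of \<tau> x] orbit.base[of \<sigma> y] by (simp add: \<tau>x)
  next
    fix z assume z: "z \<in> orbit \<tau> x \<inter> orbit \<sigma> y"
    then have "\<tau> z = \<sigma> z" using x ny by (auto simp: \<tau>_def transpose_def)
    then show "\<sigma> z \<in> orbit \<tau> x \<inter> orbit \<sigma> y"
      using z orbit.step[of z \<tau> x] orbit.step[of z \<sigma> y] by auto
  qed
  then show False using ny self_orbit[OF perm fin, of y] by auto
qed

text \<open>Applying the transposition again gives \<sigma> back, so this is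
  \<open>cut_cycle\<close> read backwards, for \<tau>.\<close>

lemma join_cycles:
  assumes perm: "\<sigma> permutes A" and fin: "finite A" and x: "x \<in> A" and y: "y \<in> A" "y \<notin> orbit \<sigma> x"
  defines "\<tau> \<equiv> \<sigma> \<circ> Transposition.transpose y x"
  shows "card (orbit \<tau> x) = card (orbit \<sigma> x) + card (orbit \<sigma> y)"
    and "other_cycles \<sigma> A x = add_mset (card (orbit \<sigma> y)) (other_cycles \<tau> A x)"
proof -
  have perm': "\<tau> permutes A"
    unfolding \<tau>_def by (rule permutes_comp_transpose[OF perm fin x y(1)])
  have xy: "x \<noteq> y" using y self_orbit[OF perm fin] by auto
  have "y \<in> orbit \<tau> x" unfolding \<tau>_def by (rule transpose_joins[OF perm fin y(2)])
  then obtain i where i: "i < card (orbit \<tau> x)" "y = (\<tau> ^^ i) x"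
    using orbit_enum(3)[OF perm' fin, of x] by (metis (no_types, lifting) atLeastLessThan_iff imageE)
  then have i0: "0 < i" using xy by (cases i) auto
  have \<sigma>: "\<tau> \<circ> Transposition.transpose ((\<tau> ^^ i) x) x = \<sigma>"
    unfolding i(2)[symmetric] by (simp add: \<tau>_def fun_eq_iff)
  note cut = cut_cycle[OF perm' fin x i0 i(1), unfolded \<sigma>, folded i(2)]
  show "card (orbit \<tau> x) = card (orbit \<sigma> x) + card (orbit \<sigma> y)"
    using cut i by simp
  show "other_cycles \<sigma> A x = add_mset (card (orbit \<sigma> y)) (other_cycles \<tau> A x)"
    using cut by simp
qed

text \<open>Before the transposition the cycles are those of both pieces together. It then absorbs
  the cycle of y into that of x, so neither marked cycle remains among the others.\<close>

lemma join_disjoint_permutations: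
  assumes fin: "finite A" and B: "B \<subseteq> A" and perm: "\<sigma> permutes A"
    and perm1: "\<sigma>1 permutes A - B" and perm2: "\<sigma>2 permutes B"
    and eq1: "\<And>z. z \<in> A - B \<Longrightarrow> \<sigma> z = \<sigma>1 z" and eq2: "\<And>z. z \<in> B \<Longrightarrow> \<sigma> z = \<sigma>2 z"
    and x: "x \<in> A - B" and y: "y \<in> B"
  defines "\<tau> \<equiv> \<sigma> \<circ> Transposition.transpose y x"
  shows "card (orbit \<tau> x) = card (orbit \<sigma>1 x) + card (orbit \<sigma>2 y)"
    and "other_cycles \<tau> A x = other_cycles \<sigma>1 (A - B) x + other_cycles \<sigma>2 B y"
proof -
  have fin1: "finite (A - B)" and fin2: "finite B" using fin B finite_subset by auto
  have o1: "orbit \<sigma> z = orbit \<sigma>1 z" if "z \<in> A - B" for z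
    using orbit_sub[OF perm1 fin1 that] eq1 by (intro orbit_cong self_orbit[OF perm1 fin1]) auto
  have o2: "orbit \<sigma> z = orbit \<sigma>2 z" if "z \<in> B" for z
    using orbit_sub[OF perm2 fin2 that] eq2 by (intro orbit_cong self_orbit[OF perm2 fin2]) auto
  have yx: "y \<notin> orbit \<sigma> x" using o1[OF x] orbit_sub[OF perm1 fin1 x] y by auto
  have 1: "orbit \<sigma> ` A - {orbit \<sigma> x} = (orbit \<sigma>1 ` (A - B) - {orbit \<sigma>1 x}) \<union> orbit \<sigma>2 ` B"
  proof -
    have "orbit \<sigma> ` A = orbit \<sigma> ` (A - B) \<union> orbit \<sigma> ` B" using B by auto
    also have "\<dots> = orbit \<sigma>1 ` (A - B) \<union> orbit \<sigma>2 ` B"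
      using o1 o2 by (intro arg_cong2[where f = "(\<union>)"] image_cong) auto
    finally have "orbit \<sigma> ` A = orbit \<sigma>1 ` (A - B) \<union> orbit \<sigma>2 ` B" .
    moreover have "orbit \<sigma>1 x \<notin> orbit \<sigma>2 ` B"
      using orbit_sub[OF perm1 fin1 x] orbit_sub[OF perm2 fin2] self_orbit[OF perm1 fin1, of x] by auto
    ultimately show ?thesis using o1[OF x] by auto
  qed
  have 2: "(orbit \<sigma>1 ` (A - B) - {orbit \<sigma>1 x}) \<inter> orbit \<sigma>2 ` B = {}"
  proof -
    have "orbit \<sigma>1 u \<noteq> orbit \<sigma>2 v" if "u \<in> A - B" "v \<in> B" for u v
      using orbit_sub[OF perm1 fin1 that(1)] orbit_sub[OF perm2 fin2 that(2)] self_orbit[OF perm1 fin1, of u] by auto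
    then show ?thesis by auto
  qed
  have "other_cycles \<sigma> A x = other_cycles \<sigma>1 (A - B) x + ctype \<sigma>2 B"
    unfolding other_cycles_def ctype_def 1 using fin1 fin2 2 by (subst mset_set_Union) auto
  also have "ctype \<sigma>2 B = add_mset (card (orbit \<sigma>2 y)) (other_cycles \<sigma>2 B y)"
    by (rule ctype_other_cycles[OF fin2 y])
  finally have r: "other_cycles \<sigma> A x = add_mset (card (orbit \<sigma>2 y)) (other_cycles \<sigma>1 (A - B) x + other_cycles \<sigma>2 B y)"
    by simp
  have xA: "x \<in> A" and yA: "y \<in> A" using x y B by auto
  note j = join_cycles[OF perm fin xA yA yx, folded \<tau>_def]
  show "card (orbit \<tau> x) = card (orbit \<sigma>1 x) + card (orbit \<sigma>2 y)"
    using j(1) o1[OF x] o2[OF y] by simp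
  show "other_cycles \<tau> A x = other_cycles \<sigma>1 (A - B) x + other_cycles \<sigma>2 B y"
    using j(2) r o2[OF y] by simp
qed

subsection \<open>Connected monotone lists of transpositions\<close>

definition pprod :: "(nat \<times> nat) list \<Rightarrow> nat \<Rightarrow> nat" where
  "pprod ts = foldr (\<lambda>(a, b) f. Transposition.transpose a b \<circ> f) ts id"

lemma pprod_Nil [simp]: "pprod [] = id"
  and pprod_Cons: "pprod ((a, b) # ts) = Transposition.transpose a b \<circ> pprod ts"
  by (simp_all add: pprod_def)

lemma pprod_snoc: "pprod (ts @ [(a, b)]) = pprod ts \<circ> Transposition.transpose a b"
proof (induction ts)
  case (Cons t ts)
  then show ?case by (cases t) (simp add: pprod_Cons comp_assoc)
qed (simp add: pprod_def)

text \<open>Paths in the graph whose edges are the transpositions; its connectedness stands in for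
  transitivity of the generated group, see \<open>transitive_on_iff_linked\<close>.\<close>

definition linked :: "(nat \<times> nat) list \<Rightarrow> (nat \<times> nat) set" where
  "linked ts = (set ts \<union> (set ts)\<inverse>)\<^sup>*"

lemma linked_refl [simp]: "(x, x) \<in> linked ts"
  by (simp add: linked_def)

lemma linked_trans: "(x, y) \<in> linked ts \<Longrightarrow> (y, z) \<in> linked ts \<Longrightarrow> (x, z) \<in> linked ts"
  unfolding linked_def by (rule rtrancl_trans)

lemma linked_sym: "(x, y) \<in> linked ts \<Longrightarrow> (y, x) \<in> linked ts"
  unfolding linked_def by (erule symD[OF sym_rtrancl, rotated]) (auto simp: sym_def)

lemma linked_edge: "(x, y) \<in> set ts \<Longrightarrow> (x, y) \<in> linked ts"
  unfolding linked_def by (rule r_into_rtrancl) simp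

lemma linked_mono: "set ts \<subseteq> set us \<Longrightarrow> linked ts \<subseteq> linked us"
  unfolding linked_def by (rule rtrancl_mono) auto

lemma linked_induct [consumes 1, case_names refl step]:
  assumes "(x, y) \<in> linked ts" "P x"
    and "\<And>y z. (x, y) \<in> linked ts \<Longrightarrow> P y \<Longrightarrow> (y, z) \<in> set ts \<or> (z, y) \<in> set ts \<Longrightarrow> P z"
  shows "P y"
proof -
  have "(x, y) \<in> (set ts \<union> (set ts)\<inverse>)\<^sup>*" using assms(1) by (simp add: linked_def)
  then show ?thesis
  proof (induction rule: rtrancl_induct)
    case (step y z)
    show ?case
    proof (rule assms(3))
      show "(x, y) \<in> linked ts" using step.hyps(1) by (simp add: linked_def)
    qed (use step in auto)
  qed (rule assms(2))
qed

text \<open>Any set of numbers may serve as ground set, so the pieces of a split keep their labels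
  and their order.\<close>

definition wf_list :: "nat set \<Rightarrow> (nat \<times> nat) list \<Rightarrow> bool" where
  "wf_list A ts \<longleftrightarrow> (\<forall>a b. (a, b) \<in> set ts \<longrightarrow> a \<in> A \<and> b \<in> A \<and> a < b) \<and> sorted (map snd ts)"

definition conn :: "nat set \<Rightarrow> (nat \<times> nat) list set" where
  "conn A = {ts. wf_list A ts \<and> (\<forall>x\<in>A. \<forall>y\<in>A. (x, y) \<in> linked ts)}"

lemma pprod_permutes: "wf_list A ts \<Longrightarrow> pprod ts permutes A"
proof (induction ts)
  case (Cons t ts)
  obtain a b where t: "t = (a, b)" by force
  from Cons have "pprod ts permutes A" "a \<in> A" "b \<in> A" by (auto simp: wf_list_def t)
  then show ?case unfolding t pprod_Cons by (intro permutes_compose permutes_swap_id)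
qed (simp add: permutes_id)

lemma conn_permutes: "ts \<in> conn A \<Longrightarrow> pprod ts permutes A"
  by (simp add: conn_def pprod_permutes)

text \<open>For a set that \<open>separates\<close> the list, the larger entry decides. Testing the
  sort key alone keeps entries with equal keys on the same side.\<close>

definition restr :: "nat set \<Rightarrow> (nat \<times> nat) list \<Rightarrow> (nat \<times> nat) list" where
  "restr S ts = filter (\<lambda>t. snd t \<in> S) ts"

definition separates :: "nat set \<Rightarrow> (nat \<times> nat) list \<Rightarrow> bool" where
  "separates S ts \<longleftrightarrow> (\<forall>a b. (a, b) \<in> set ts \<longrightarrow> (a \<in> S \<longleftrightarrow> b \<in> S))"

text \<open>A point of S never leaves S, and the transpositions outside S fix it.\<close>

lemma pprod_restr:
  assumes "separates S ts" "x \<in> S"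
  shows "pprod ts x \<in> S \<and> pprod ts x = pprod (restr S ts) x"
  using assms(1)
proof (induction ts)
  case (Cons t ts)
  obtain a b where t: "t = (a, b)" by force
  from Cons have IH: "pprod ts x \<in> S" "pprod ts x = pprod (restr S ts) x"
    and ab: "a \<in> S \<longleftrightarrow> b \<in> S"
    by (auto simp: separates_def t)
  show ?case
    proof (cases "b \<in> S")
      case True
      then have "restr S (t # ts) = t # restr S ts" by (simp add: restr_def t)
      moreover have "Transposition.transpose a b (pprod ts x) \<in> S"
        using IH(1) True ab by (simp add: transpose_def)
      ultimately show ?thesis using IH(2) by (simp add: t pprod_Cons)
    next
      case False
      then have "restr S (t # ts) = restr S ts" by (simp add: restr_def t)
      moreover have "Transposition.transpose a b (pprod ts x) = pprod ts x"
        using IH(1) False ab by (intro transpose_apply_other) auto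
      ultimately show ?thesis using IH(2) IH(1) by (simp add: t pprod_Cons)
    qed
qed (use assms(2) in \<open>simp add: restr_def\<close>)

lemma separates_Diff: "wf_list A ts \<Longrightarrow> separates B ts \<Longrightarrow> separates (A - B) ts"
  by (simp add: wf_list_def separates_def)

lemma wf_list_snd: "wf_list A ts \<Longrightarrow> t \<in> set ts \<Longrightarrow> snd t \<in> A"
  unfolding wf_list_def by (cases t) auto

lemma wf_restr:
  assumes "wf_list A ts" "separates S ts"
  shows "wf_list S (restr S ts)"
  unfolding wf_list_def
proof (intro conjI allI impI)
  show "sorted (map snd (restr S ts))"
    using assms(1) unfolding wf_list_def restr_def by (intro sorted_filter) simp
  fix a b assume "(a, b) \<in> set (restr S ts)"
  then have "(a, b) \<in> set ts" "b \<in> S" by (auto simp: restr_def)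
  then show "a \<in> S" "b \<in> S" "a < b"
    using assms by (simp_all add: wf_list_def separates_def)
qed

lemma wf_list_mono: "wf_list A ts \<Longrightarrow> A \<subseteq> A' \<Longrightarrow> wf_list A' ts"
  unfolding wf_list_def by blast

lemma linked_restr:
  assumes "separates S ts" "x \<in> S" "(x, y) \<in> linked ts"
  shows "y \<in> S \<and> (x, y) \<in> linked (restr S ts)"
  using assms(3)
proof (induction rule: linked_induct)
  case (step y z)
  from step.IH have yz: "y \<in> S" "(x, y) \<in> linked (restr S ts)" by auto
  have "p \<in> S \<longleftrightarrow> q \<in> S" if "(p, q) \<in> set ts" for p q
    using assms(1) that by (auto simp: separates_def)
  from this[of y z] this[of z y] have "z \<in> S" using step.hyps(2) yz by auto
  then have "(y, z) \<in> set (restr S ts) \<or> (z, y) \<in> set (restr S ts)"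
    using step.hyps(2) yz \<open>z \<in> S\<close> by (auto simp: restr_def)
  then have "(y, z) \<in> linked (restr S ts)" by (metis linked_edge linked_sym)
  then show ?case using yz \<open>z \<in> S\<close> linked_trans by blast
qed (use assms in auto)

lemma separates_component: "separates {z \<in> A. (a, z) \<in> linked ts} ts" if "wf_list A ts"
  unfolding separates_def
proof (intro allI impI)
  fix p q assume pq: "(p, q) \<in> set ts"
  then have "p \<in> A" "q \<in> A" using that by (auto simp: wf_list_def)
  moreover have "(a, p) \<in> linked ts \<longleftrightarrow> (a, q) \<in> linked ts"
    using linked_trans[OF _ linked_edge[OF pq]] linked_trans[OF _ linked_sym[OF linked_edge[OF pq]]] by auto
  ultimately show "p \<in> {z \<in> A. (a, z) \<in> linked ts} \<longleftrightarrow> q \<in> {z \<in> A. (a, z) \<in> linked ts}" by auto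
qed

lemma component_conn:
  assumes "wf_list A ts" "S = {z \<in> A. (a, z) \<in> linked ts}" "a \<in> A"
  shows "restr S ts \<in> conn S"
proof -
  have sep: "separates S ts" unfolding assms(2) by (rule separates_component[OF assms(1)])
  have "wf_list S (restr S ts)"
    by (rule wf_restr[OF assms(1) sep])
  moreover have "(x, y) \<in> linked (restr S ts)" if "x \<in> S" "y \<in> S" for x y
  proof -
    have "(x, y) \<in> linked ts"
      using that unfolding assms(2) by (blast intro: linked_sym linked_trans)
    then show ?thesis using linked_restr[OF sep that(1)] by blast
  qed
  ultimately show ?thesis by (auto simp: conn_def)
qed

lemma conn_singleton: "conn {d} = {[]}"
proof -
  have "ts = []" if "ts \<in> conn {d}" for ts
    using that by (cases ts) (auto simp: conn_def wf_list_def)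
  then show ?thesis by (auto simp: conn_def wf_list_def)
qed

text \<open>Connectedness forces the maximum into some transposition, necessarily as its larger
  entry. By monotonicity the last larger entry is then the maximum too.\<close>

lemma conn_last:
  assumes ts: "ts \<in> conn A" and fin: "finite A" and card: "card A \<ge> 2"
  obtains ts' a where "ts = ts' @ [(a, Max A)]" "a \<in> A - {Max A}" "wf_list A ts'"
proof -
  have wf: "wf_list A ts" and con: "\<And>x y. x \<in> A \<Longrightarrow> y \<in> A \<Longrightarrow> (x, y) \<in> linked ts"
    using ts by (auto simp: conn_def)
  define d where "d = Max A"
  have "A \<noteq> {}" using card by auto
  then have d: "d \<in> A" using fin by (simp add: d_def)
  have dmax: "z \<le> d" if "z \<in> A" for z using that fin by (simp add: d_def)
  have "\<not> A \<subseteq> {d}"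
    using card card_mono[of "{d}" A] by auto
  then obtain e where e: "e \<in> A" "e \<noteq> d" by auto
  have "e = d" if no: "\<And>u. (u, d) \<notin> set ts"
    using con[OF d e(1)]
  proof (induction rule: linked_induct)
    case (step y z)
    then show ?case using no wf dmax[of z] unfolding wf_list_def by fastforce
  qed simp
  then obtain u where u: "(u, d) \<in> set ts" using e by auto
  then obtain ts' a b where ts': "ts = ts' @ [(a, b)]"
    by (metis append_butlast_last_id empty_iff empty_set surj_pair)
  have ab: "a \<in> A" "b \<in> A" "a < b" using wf by (auto simp: ts' wf_list_def)
  have "d \<le> b"
    using u wf by (auto simp: ts' wf_list_def sorted_append)
  then have "b = d" using dmax[of b] ab by auto
  moreover have "wf_list A ts'" using wf by (auto simp: ts' wf_list_def sorted_append)
  ultimately show ?thesis using that[of ts' a] ts' ab by (auto simp: d_def)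
qed

text \<open>
  If \<open>ts\<close> and \<open>us\<close> are monotone and live on disjoint sets, then their second components are
  disjoint too, so sorting yields their only monotone interleaving.
\<close>

definition merge :: "(nat \<times> nat) list \<Rightarrow> (nat \<times> nat) list \<Rightarrow> (nat \<times> nat) list" where
  "merge ts us = sort_key snd (ts @ us)"

lemma set_merge [simp]: "set (merge ts us) = set ts \<union> set us"
  by (simp add: merge_def)

lemma length_merge [simp]: "length (merge ts us) = length ts + length us"
  by (simp add: merge_def)

lemma restr_merge:
  assumes "wf_list S ts" "wf_list T us" "S \<inter> T = {}"
  shows "restr S (merge ts us) = ts" "restr T (merge ts us) = us"
proof -
  have s: "snd t \<in> S" "snd t \<notin> T" if "t \<in> set ts" for t
    using wf_list_snd[OF assms(1) that] assms(3) by auto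
  have u: "snd t \<in> T" "snd t \<notin> S" if "t \<in> set us" for t
    using wf_list_snd[OF assms(2) that] assms(3) by auto
  have "filter (\<lambda>t. snd t \<in> S) ts = ts" "filter (\<lambda>t. snd t \<in> S) us = []"
    "filter (\<lambda>t. snd t \<in> T) ts = []" "filter (\<lambda>t. snd t \<in> T) us = us"
    by (simp_all add: filter_id_conv filter_empty_conv s u)
  then show "restr S (merge ts us) = ts" "restr T (merge ts us) = us"
    using assms(1,2) by (simp_all add: restr_def merge_def filter_sort wf_list_def sort_key_id_if_sorted)
qed

text \<open>Entries with the same second component all come from one side, so stability of the sort
  restores their original order.\<close>

lemma merge_restr:
  assumes "wf_list A ts" "S \<union> T = A" "S \<inter> T = {}"
  shows "merge (restr S ts) (restr T ts) = ts"
  unfolding merge_def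
proof (rule properties_for_sort_key)
  have part: "filter (\<lambda>t. snd t \<in> T) ts = filter (\<lambda>t. snd t \<notin> S) ts"
    using wf_list_snd[OF assms(1)] assms(2,3) by (intro filter_cong) auto
  show "mset ts = mset (restr S ts @ restr T ts)"
    unfolding restr_def part by simp
  show "sorted (map snd ts)" using assms by (simp add: wf_list_def)
  fix k assume "k \<in> set ts"
  show "filter (\<lambda>x. snd k = snd x) ts = filter (\<lambda>x. snd k = snd x) (restr S ts @ restr T ts)"
  proof (cases "snd k \<in> S")
    case True
    then have "filter (\<lambda>x. snd k = snd x) (restr S ts) = filter (\<lambda>x. snd k = snd x) ts"
      "filter (\<lambda>x. snd k = snd x) (restr T ts) = []"
      using assms(3) by (auto simp: restr_def filter_empty_conv intro!: filter_cong)
    then show ?thesis by simp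
  next
    case False
    then have "filter (\<lambda>x. snd k = snd x) (restr T ts) = filter (\<lambda>x. snd k = snd x) ts"
      "filter (\<lambda>x. snd k = snd x) (restr S ts) = []"
      unfolding restr_def part by (auto simp: filter_empty_conv intro!: filter_cong)
    then show ?thesis by simp
  qed
qed

lemma wf_merge:
  assumes "wf_list S ts" "wf_list T us" "S \<subseteq> A" "T \<subseteq> A"
  shows "wf_list A (merge ts us)"
proof -
  have "wf_list A ts" "wf_list A us" using assms wf_list_mono by blast+
  then show ?thesis by (auto simp: wf_list_def merge_def)
qed

lemma separates_merge:
  assumes "wf_list S ts" "wf_list T us" "S \<inter> T = {}"
  shows "separates S (merge ts us)"
  unfolding separates_def
proof (intro allI impI)
  fix a b assume "(a, b) \<in> set (merge ts us)"
  then have "(a, b) \<in> set ts \<or> (a, b) \<in> set us" by simp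
  then have "a \<in> S \<and> b \<in> S \<or> a \<in> T \<and> b \<in> T" using assms(1,2) unfolding wf_list_def by metis
  then show "a \<in> S \<longleftrightarrow> b \<in> S" using assms(3) by auto
qed

lemma conn_snoc:
  assumes wf: "wf_list A ts" and ab: "a \<in> A" "b \<in> A" "a < b" "\<And>z. z \<in> A \<Longrightarrow> z \<le> b"
    and link: "\<And>z. z \<in> A \<Longrightarrow> (a, z) \<in> linked ts \<or> (b, z) \<in> linked ts"
  shows "ts @ [(a, b)] \<in> conn A"
proof -
  have "wf_list A (ts @ [(a, b)])"
    using wf ab unfolding wf_list_def by (auto simp: sorted_append)
  moreover have *: "(a, z) \<in> linked (ts @ [(a, b)])" if z: "z \<in> A" for z
  proof -
    have mono: "(x, y) \<in> linked ts \<Longrightarrow> (x, y) \<in> linked (ts @ [(a, b)])" for x y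
      using linked_mono[of ts "ts @ [(a, b)]"] by auto
    have "(a, b) \<in> linked (ts @ [(a, b)])" by (rule linked_edge) simp
    then show ?thesis using link[OF z] mono linked_trans by blast
  qed
  ultimately show ?thesis
    unfolding conn_def using * by (blast intro: linked_sym linked_trans)
qed

text \<open>So dropping the last edge of a connected list leaves at most two components, those of
  its endpoints.\<close>

lemma linked_snoc:
  assumes "(b, z) \<in> linked (ts @ [(a, b)])"
  shows "(a, z) \<in> linked ts \<or> (b, z) \<in> linked ts"
  using assms
proof (induction rule: linked_induct)
  case (step y z)
  show ?case
  proof (cases "(y, z) \<in> set ts \<or> (z, y) \<in> set ts")
    case True
    then have "(y, z) \<in> linked ts" by (metis linked_edge linked_sym)
    then show ?thesis using step.IH linked_trans[of _ y ts z] by blast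
  next
    case False
    then have "z = a \<or> z = b" using step.hyps(2) by auto
    then show ?thesis by auto
  qed
qed simp

subsection \<open>Removing the last transposition\<close>

text \<open>If d lay in the component B of a, the shortened list would still be connected. So B and
  A - B are its two components.\<close>

lemma conn_split:
  assumes a: "a \<in> A" and d: "d \<in> A"
    and ts: "ts @ [(a, d)] \<in> conn A" "ts \<notin> conn A"
  defines "B \<equiv> {z \<in> A. (a, z) \<in> linked ts}"
  shows "a \<in> B" "d \<notin> B" "restr (A - B) ts \<in> conn (A - B)" "restr B ts \<in> conn B"
    "merge (restr (A - B) ts) (restr B ts) = ts"
proof -
  have wf: "wf_list A ts" using ts(1) by (auto simp: conn_def wf_list_def sorted_append)
  have link: "(a, z) \<in> linked ts \<or> (d, z) \<in> linked ts" if "z \<in> A" for z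
    by (rule linked_snoc) (use ts(1) d that in \<open>simp add: conn_def\<close>)
  show "a \<in> B" using a by (simp add: B_def)
  show dB: "d \<notin> B"
  proof
    assume "d \<in> B"
    then have ad: "(a, d) \<in> linked ts" by (simp add: B_def)
    have az: "(a, z) \<in> linked ts" if "z \<in> A" for z
      using link[OF that] linked_trans[OF ad, of z] by auto
    have "(x, y) \<in> linked ts" if "x \<in> A" "y \<in> A" for x y
      by (rule linked_trans[OF linked_sym[OF az[OF that(1)]] az[OF that(2)]])
    then show False using ts(2) wf by (simp add: conn_def)
  qed
  have AB: "A - B = {z \<in> A. (d, z) \<in> linked ts}"
  proof (intro equalityI subsetI)
    fix z assume "z \<in> A - B"
    then show "z \<in> {z \<in> A. (d, z) \<in> linked ts}" using link[of z] by (auto simp: B_def)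
  next
    fix z assume z: "z \<in> {z \<in> A. (d, z) \<in> linked ts}"
    have "z \<notin> B"
    proof
      assume "z \<in> B"
      then have "(a, d) \<in> linked ts" using z linked_trans[OF _ linked_sym, of a z ts d] by (simp add: B_def)
      then show False using dB d by (simp add: B_def)
    qed
    then show "z \<in> A - B" using z by simp
  qed
  show "restr (A - B) ts \<in> conn (A - B)"
    by (rule component_conn[OF wf AB d])
  show "restr B ts \<in> conn B"
    by (rule component_conn[OF wf B_def[THEN meta_eq_to_obj_eq] a])
  have "A - B \<union> B = A" "(A - B) \<inter> B = {}" by (auto simp: B_def)
  then show "merge (restr (A - B) ts) (restr B ts) = ts"
    by (rule merge_restr[OF wf])
qed

context
  fixes A B :: "nat set" and a d :: nat and ts1 ts2 :: "(nat \<times> nat) list"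
  assumes fin: "finite A" and BA: "B \<subseteq> A" and ts1: "ts1 \<in> conn (A - B)" and ts2: "ts2 \<in> conn B"
    and d: "d \<in> A - B" and a: "a \<in> B"
begin

lemma wf_parts: "wf_list (A - B) ts1" "wf_list B ts2" "wf_list A (merge ts1 ts2)"
proof -
  show 1: "wf_list (A - B) ts1" and 2: "wf_list B ts2" using ts1 ts2 by (simp_all add: conn_def)
  show "wf_list A (merge ts1 ts2)" by (rule wf_merge[OF 1 2]) (use BA in auto)
qed

lemma separates_parts: "separates (A - B) (merge ts1 ts2)" "separates B (merge ts1 ts2)"
proof -
  show 1: "separates (A - B) (merge ts1 ts2)"
    by (rule separates_merge[OF wf_parts(1,2)]) auto
  have "A - (A - B) = B" using BA by auto
  then show "separates B (merge ts1 ts2)"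
    using separates_Diff[OF wf_parts(3) 1] by simp
qed

lemma restr_parts: "restr (A - B) (merge ts1 ts2) = ts1" "restr B (merge ts1 ts2) = ts2"
  by (rule restr_merge[OF wf_parts(1,2)]; auto)+

text \<open>Recovers B, and with it both lists, from the merged list and a; needed for the inverse
  map in \<open>bij_betw_split\<close>.\<close>

lemma merge_component: "{z \<in> A. (a, z) \<in> linked (merge ts1 ts2)} = B"
proof (intro equalityI subsetI)
  fix z assume "z \<in> {z \<in> A. (a, z) \<in> linked (merge ts1 ts2)}"
  then show "z \<in> B" using linked_restr[OF separates_parts(2) a, of z] by simp
next
  fix z assume z: "z \<in> B"
  have "(a, z) \<in> linked ts2" using ts2 a z by (simp add: conn_def)
  then show "z \<in> {z \<in> A. (a, z) \<in> linked (merge ts1 ts2)}"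
    using linked_mono[of ts2 "merge ts1 ts2"] z BA by auto
qed

lemma merge_not_conn: "merge ts1 ts2 \<notin> conn A"
proof
  assume "merge ts1 ts2 \<in> conn A"
  then have "(a, d) \<in> linked (merge ts1 ts2)" using a d BA by (auto simp: conn_def)
  then have "d \<in> B" using merge_component d by blast
  then show False using d by simp
qed

lemma merge_conn:
  assumes "d = Max A"
  shows "merge ts1 ts2 @ [(a, d)] \<in> conn A"
proof (rule conn_snoc[OF wf_parts(3)])
  show aA: "a \<in> A" and "d \<in> A" using a d BA by auto
  show le: "z \<le> d" if "z \<in> A" for z using that fin by (simp add: assms)
  have "a \<noteq> d" using a d by auto
  then show "a < d" using le[OF aA] by simp
  fix z assume z: "z \<in> A"
  show "(a, z) \<in> linked (merge ts1 ts2) \<or> (d, z) \<in> linked (merge ts1 ts2)"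
  proof (cases "z \<in> B")
    case True
    then show ?thesis using merge_component by blast
  next
    case False
    then have "(d, z) \<in> linked ts1" using ts1 d z by (simp add: conn_def)
    then show ?thesis using linked_mono[of ts1 "merge ts1 ts2"] by auto
  qed
qed

lemma merge_type:
  "card (orbit (pprod (merge ts1 ts2 @ [(a, d)])) d) = card (orbit (pprod ts1) d) + card (orbit (pprod ts2) a)"
  "other_cycles (pprod (merge ts1 ts2 @ [(a, d)])) A d = other_cycles (pprod ts1) (A - B) d + other_cycles (pprod ts2) B a"
proof -
  have eq1: "pprod (merge ts1 ts2) z = pprod ts1 z" if "z \<in> A - B" for z
    using pprod_restr[OF separates_parts(1) that] by (simp add: restr_parts)
  have eq2: "pprod (merge ts1 ts2) z = pprod ts2 z" if "z \<in> B" for z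
    using pprod_restr[OF separates_parts(2) that] by (simp add: restr_parts)
  note join_disjoint_permutations[OF fin BA pprod_permutes[OF wf_parts(3)] conn_permutes[OF ts1] conn_permutes[OF ts2] eq1 eq2 d a]
  then show "card (orbit (pprod (merge ts1 ts2 @ [(a, d)])) d) = card (orbit (pprod ts1) d) + card (orbit (pprod ts2) a)"
    "other_cycles (pprod (merge ts1 ts2 @ [(a, d)])) A d = other_cycles (pprod ts1) (A - B) d + other_cycles (pprod ts2) B a"
    by (simp_all add: pprod_snoc)
qed

end

lemma size_other_cycles: "finite A \<Longrightarrow> x \<in> A \<Longrightarrow> Suc (size (other_cycles \<sigma> A x)) = size (ctype \<sigma> A)"
  using ctype_other_cycles[of A x \<sigma>] by simp

lemma type_snoc_same_cycle:
  assumes fin: "finite A" and ts: "wf_list A ts" and d: "d \<in> A" and ad: "a \<noteq> d" "a \<in> orbit (pprod ts) d"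
  obtains i where "0 < i" "a = (pprod ts ^^ i) d"
    "card (orbit (pprod (ts @ [(a, d)])) a) = i"
    "card (orbit (pprod ts) d) = card (orbit (pprod (ts @ [(a, d)])) d) + i"
    "other_cycles (pprod (ts @ [(a, d)])) A d = add_mset i (other_cycles (pprod ts) A d)"
proof -
  note perm = pprod_permutes[OF ts]
  have "a \<in> (\<lambda>j. (pprod ts ^^ j) d) ` {0..<card (orbit (pprod ts) d)}"
    using ad(2) orbit_enum(3)[OF perm fin, of d] by simp
  then obtain i where i: "i < card (orbit (pprod ts) d)" "a = (pprod ts ^^ i) d" by auto
  then have i0: "0 < i" using ad(1) by (cases i) auto
  note cut = cut_cycle[OF perm fin d i0 i(1), folded i(2)]
  show ?thesis
    by (rule that[of i]) (use i i0 cut in \<open>simp_all add: pprod_snoc\<close>)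
qed

lemma type_snoc_other_cycle:
  assumes fin: "finite A" and ts: "wf_list A ts" and d: "d \<in> A" and a: "a \<in> A" "a \<notin> orbit (pprod ts) d"
  shows "size (other_cycles (pprod ts) A d) = Suc (size (other_cycles (pprod (ts @ [(a, d)])) A d))"
  using join_cycles(2)[OF pprod_permutes[OF ts] fin d a] by (simp add: pprod_snoc)

text \<open>The genus is nonnegative.\<close>

lemma conn_length_Max:
  assumes "finite A" "A \<noteq> {}" "ts \<in> conn A"
  shows "card A + size (other_cycles (pprod ts) A (Max A)) \<le> Suc (length ts)"
  using assms
proof (induction "length ts" arbitrary: ts A rule: less_induct)
  case less
  note fin = less.prems(1) and ne = less.prems(2) and ts = less.prems(3)
  define d where "d = Max A"
  have d: "d \<in> A" using fin ne by (simp add: d_def)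
  have IH: "card A' + size (other_cycles (pprod ts') A' x) \<le> Suc (length ts')"
    if "length ts' < length ts" "ts' \<in> conn A'" "x \<in> A'" "finite A'" for ts' A' x
  proof -
    have "Max A' \<in> A'" using that(3,4) by (intro Max_in) auto
    then have "size (other_cycles (pprod ts') A' x) = size (other_cycles (pprod ts') A' (Max A'))"
      using size_other_cycles[OF that(4,3), of "pprod ts'"] size_other_cycles[OF that(4), of "Max A'" "pprod ts'"] by simp
    then show ?thesis using less.hyps[OF that(1,4) _ that(2)] that(3) by auto
  qed
  show ?case
  proof (cases "card A \<ge> 2")
    case False
    moreover have "card A \<noteq> 0" using fin ne by simp
    ultimately have "card A = 1" by linarith
    then have A: "A = {d}" using d by (metis card_1_singletonE singletonD)
    then show ?thesis using d by (simp add: other_cycles_def)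
  next
    case True
    obtain ts' a where ts': "ts = ts' @ [(a, d)]" and a: "a \<in> A - {d}" and wf: "wf_list A ts'"
      using conn_last[OF ts fin True] unfolding d_def by blast
    have aA: "a \<in> A" using a by simp
    show ?thesis
    proof (cases "ts' \<in> conn A")
      case True
      then have b: "card A + size (other_cycles (pprod ts') A d) \<le> Suc (length ts')"
        by (intro IH) (use fin d ts' in auto)
      show ?thesis
      proof (cases "a \<in> orbit (pprod ts') d")
        case True
        then obtain i where "other_cycles (pprod (ts' @ [(a, d)])) A d = add_mset i (other_cycles (pprod ts') A d)"
          using type_snoc_same_cycle[OF fin wf d] a by blast
        \<comment> \<open>A cut adds one transposition and one cycle: the genus is
          unchanged.\<close>
        then show ?thesis using b by (simp add: ts' d_def[symmetric])
      next
        case False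
        \<comment> \<open>A join adds a transposition and loses a cycle: the slack grows by two, the
          genus by one.\<close>
        then show ?thesis using b type_snoc_other_cycle[OF fin wf d aA] by (simp add: ts' d_def[symmetric])
      qed
    next
      case False
      define B where "B = {z \<in> A. (a, z) \<in> linked ts'}"
      define ts1 where "ts1 = restr (A - B) ts'"
      define ts2 where "ts2 = restr B ts'"
      note split = conn_split[OF aA d ts[unfolded ts'] False, folded B_def, folded ts1_def ts2_def]
      have BA: "B \<subseteq> A" by (auto simp: B_def)
      have dB: "d \<in> A - B" using d split(2) by simp
      have len: "length ts = Suc (length ts1 + length ts2)"
        using arg_cong[OF split(5), of length] by (simp add: ts')
      have 1: "card (A - B) + size (other_cycles (pprod ts1) (A - B) d) \<le> Suc (length ts1)"
        by (rule IH) (use split fin dB len in auto)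
      have 2: "card B + size (other_cycles (pprod ts2) B a) \<le> Suc (length ts2)"
        by (rule IH) (use split fin BA finite_subset len in auto)
      have "other_cycles (pprod ts) A d = other_cycles (pprod ts1) (A - B) d + other_cycles (pprod ts2) B a"
        using merge_type(2)[OF fin BA split(3,4) dB split(1)] by (simp add: split(5) ts')
      moreover have "card A = card (A - B) + card B"
        using fin BA by (metis card_Diff_subset card_mono finite_subset le_add_diff_inverse2)
      \<comment> \<open>Cardinalities and numbers of other cycles add up; the new transposition
        accounts for the second \<open>Suc\<close>.\<close>
      ultimately show ?thesis using 1 2 len by (simp add: d_def[symmetric])
    qed
  qed
qed

lemma conn_length:
  assumes "finite A" "ts \<in> conn A" "x \<in> A"
  shows "card A + size (other_cycles (pprod ts) A x) \<le> Suc (length ts)"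
proof -
  have "Max A \<in> A" using assms(1,3) by (intro Max_in) auto
  then have "size (other_cycles (pprod ts) A x) = size (other_cycles (pprod ts) A (Max A))"
    using size_other_cycles[OF assms(1,3), of "pprod ts"] size_other_cycles[OF assms(1), of "Max A" "pprod ts"] by simp
  then show ?thesis using conn_length_Max[OF assms(1) _ assms(2)] assms(3) by auto
qed

text \<open>The condition on the length says that the genus is zero.\<close>

definition pointed :: "nat set \<Rightarrow> nat \<Rightarrow> nat multiset \<Rightarrow> ((nat \<times> nat) list \<times> nat) set" where
  "pointed A k \<beta> = {(ts, x). ts \<in> conn A \<and> x \<in> A \<and> Suc (length ts) = card A + size \<beta> \<and>
     card (orbit (pprod ts) x) = k \<and> other_cycles (pprod ts) A x = \<beta>}"

definition rooted :: "nat set \<Rightarrow> nat \<Rightarrow> nat multiset \<Rightarrow> (nat \<times> nat) list set" where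
  "rooted A k \<beta> = {ts. (ts, Max A) \<in> pointed A k \<beta>}"

definition of_type :: "nat set \<Rightarrow> nat multiset \<Rightarrow> (nat \<times> nat) list set" where
  "of_type A \<alpha> = {ts \<in> conn A. length ts + 2 = card A + size \<alpha> \<and> ctype (pprod ts) A = \<alpha>}"

section \<open>Double counting by marked points and by the cycle of the maximum\<close>

lemma finite_conn: "finite A \<Longrightarrow> finite {ts \<in> conn A. length ts = n}"
proof (rule finite_subset)
  show "{ts \<in> conn A. length ts = n} \<subseteq> {ts. set ts \<subseteq> A \<times> A \<and> length ts = n}"
    by (auto simp: conn_def wf_list_def)
qed (simp add: finite_lists_length_eq)

lemma finite_of_type: "finite A \<Longrightarrow> finite (of_type A \<alpha>)"
  by (rule finite_subset[OF _ finite_conn[of A "card A + size \<alpha> - 2"]]) (auto simp: of_type_def)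

lemma finite_rooted: "finite A \<Longrightarrow> finite (rooted A k \<beta>)"
  by (rule finite_subset[OF _ finite_conn[of A "card A + size \<beta> - 1"]]) (auto simp: rooted_def pointed_def)

lemma finite_pointed: "finite A \<Longrightarrow> finite (pointed A k \<beta>)"
  by (rule finite_subset[OF _ finite_cartesian_product[OF finite_conn[of A "card A + size \<beta> - 1"]]])
     (auto simp: pointed_def)

lemma card_pointed_nonempty:
  assumes "(ts, x) \<in> pointed A k \<beta>" "finite A"
  shows "card A = k + sum_mset \<beta>"
proof -
  have *: "pprod ts permutes A" "x \<in> A" "k = card (orbit (pprod ts) x)" "\<beta> = other_cycles (pprod ts) A x"
    using assms conn_permutes by (auto simp: pointed_def)
  then show ?thesis
    using card_orbit_other_cycles[OF *(1) assms(2) *(2)] by simp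
qed

lemma pointed_ctype:
  assumes "finite A"
  shows "(ts, x) \<in> pointed A k \<beta> \<longleftrightarrow> ts \<in> of_type A (add_mset k \<beta>) \<and> x \<in> A \<and> card (orbit (pprod ts) x) = k"
  using ctype_other_cycles[OF assms, of x "pprod ts"] by (auto simp: pointed_def of_type_def)

text \<open>Fix the list first: k occurs \<open>Suc (count \<beta> k)\<close> times in its cycle
  type, and each such cycle offers k points to mark.\<close>

lemma card_pointed:
  assumes fin: "finite A"
  shows "card (pointed A k \<beta>) = k * Suc (count \<beta> k) * card (of_type A (add_mset k \<beta>))"
proof -
  have "pointed A k \<beta> = Sigma (of_type A (add_mset k \<beta>)) (\<lambda>ts. {x \<in> A. card (orbit (pprod ts) x) = k})"
    using pointed_ctype[OF fin] by auto
  also have "card \<dots> = (\<Sum>ts\<in>of_type A (add_mset k \<beta>). card {x \<in> A. card (orbit (pprod ts) x) = k})"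
    using fin finite_of_type[OF fin] by (intro card_SigmaI) auto
  also have "\<dots> = (\<Sum>ts\<in>of_type A (add_mset k \<beta>). k * Suc (count \<beta> k))"
  proof (rule sum.cong)
    fix ts assume ts: "ts \<in> of_type A (add_mset k \<beta>)"
    then have "pprod ts permutes A" by (simp add: of_type_def conn_permutes)
    from card_points_in_cycles[OF this fin] show "card {x \<in> A. card (orbit (pprod ts) x) = k} = k * Suc (count \<beta> k)"
      using ts by (simp add: of_type_def)
  qed simp
  finally show ?thesis by (simp add: mult.commute)
qed

lemma card_of_type:
  assumes fin: "finite A" and ne: "A \<noteq> {}"
  shows "card (of_type A \<alpha>) = (\<Sum>k\<in>set_mset \<alpha>. card (rooted A k (\<alpha> - {#k#})))"
proof -
  have M: "Max A \<in> A" using fin ne by simp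
  have iff: "ts \<in> rooted A k (\<alpha> - {#k#}) \<longleftrightarrow> ts \<in> of_type A \<alpha> \<and> card (orbit (pprod ts) (Max A)) = k"
    if "k \<in># \<alpha>" for ts k
    unfolding rooted_def using pointed_ctype[OF fin, of ts "Max A" k "\<alpha> - {#k#}"] M that by simp
  have "of_type A \<alpha> = (\<Union>k\<in>set_mset \<alpha>. rooted A k (\<alpha> - {#k#}))"
  proof (intro equalityI subsetI)
    fix ts assume ts: "ts \<in> of_type A \<alpha>"
    then have "\<alpha> = add_mset (card (orbit (pprod ts) (Max A))) (other_cycles (pprod ts) A (Max A))"
      using ctype_other_cycles[OF fin M] by (simp add: of_type_def)
    then have "card (orbit (pprod ts) (Max A)) \<in># \<alpha>" by (metis union_single_eq_member)
    then show "ts \<in> (\<Union>k\<in>set_mset \<alpha>. rooted A k (\<alpha> - {#k#}))" using ts iff by blast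
  qed (use iff in auto)
  also have "card \<dots> = (\<Sum>k\<in>set_mset \<alpha>. card (rooted A k (\<alpha> - {#k#})))"
    by (rule card_UN_disjoint) (use iff finite_rooted[OF fin] in auto)
  finally show ?thesis .
qed

section \<open>The two bijections behind the recursion\<close>

lemma rooted_snoc_cases:
  assumes fin: "finite A" and card: "card A \<ge> 2" and ts: "ts \<in> rooted A k \<beta>"
  obtains ts' a where "ts = ts' @ [(a, Max A)]" "a \<in> A" "a \<noteq> Max A" "wf_list A ts'" "ts \<in> conn A"
    "Suc (length ts) = card A + size \<beta>" "card (orbit (pprod ts) (Max A)) = k" "other_cycles (pprod ts) A (Max A) = \<beta>"
proof -
  have con: "ts \<in> conn A" using ts by (simp add: rooted_def pointed_def)
  obtain ts' a where "ts = ts' @ [(a, Max A)]" "a \<in> A - {Max A}" "wf_list A ts'"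
    by (rule conn_last[OF con fin card])
  with con ts show ?thesis by (intro that[of ts' a]) (auto simp: rooted_def pointed_def)
qed

text \<open>
  If the list stays connected after its last transposition is dropped, then this transposition cuts a
  cycle: if it joined two cycles, the shortened list would violate \<open>conn_length\<close>.
\<close>

lemma bij_betw_cut:
  assumes fin: "finite A" and card: "card A \<ge> 2" and k: "k \<ge> 1" and \<beta>: "0 \<notin># \<beta>"
  shows "bij_betw (\<lambda>(m, ts). ts @ [((pprod ts ^^ m) (Max A), Max A)])
    (Sigma (set_mset \<beta>) (\<lambda>m. rooted A (k + m) (\<beta> - {#m#}))) {ts \<in> rooted A k \<beta>. butlast ts \<in> conn A}"
    (is "bij_betw ?f ?X ?Y")
proof -
  define d where "d = Max A"
  have d: "d \<in> A" using fin card unfolding d_def by (intro Max_in) auto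
  \<comment> \<open>The inverse map: the cycle cut off contains a and has length m, so m can be read
    off the longer list.\<close>
  define g where "g ts = (card (orbit (pprod ts) (fst (last ts))), butlast ts)" for ts :: "(nat \<times> nat) list"
  have f: "?f (m, ts) \<in> ?Y \<and> g (?f (m, ts)) = (m, ts)"
    if m: "m \<in># \<beta>" and ts: "ts \<in> rooted A (k + m) (\<beta> - {#m#})" for m ts
  proof -
    have con: "ts \<in> conn A" and len: "Suc (length ts) = card A + size (\<beta> - {#m#})"
      and orb: "card (orbit (pprod ts) d) = k + m" and rst: "other_cycles (pprod ts) A d = \<beta> - {#m#}"
      using ts by (auto simp: rooted_def pointed_def d_def)
    have wf: "wf_list A ts" using con by (simp add: conn_def)
    have m0: "0 < m" using m \<beta> by (cases m) auto
    have mk: "m < card (orbit (pprod ts) d)" using orb k by simp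
    define a where "a = (pprod ts ^^ m) d"
    note cut = cut_cycle[OF conn_permutes[OF con] fin d m0 mk, folded a_def, folded pprod_snoc]
    have le: "z \<le> d" if "z \<in> A" for z using fin that by (simp add: d_def)
    have "ts @ [(a, d)] \<in> conn A"
    proof (rule conn_snoc[OF wf cut(1) d _ le])
      show "a < d" using le[OF cut(1)] cut(2) by simp
      show "(a, z) \<in> linked ts \<or> (d, z) \<in> linked ts" if "z \<in> A" for z
        using con d that by (simp add: conn_def)
    qed
    moreover have "Suc (length (ts @ [(a, d)])) = card A + size \<beta>"
      using len size_add_mset[of m "\<beta> - {#m#}"] insert_DiffM[OF m] by simp
    moreover have "card (orbit (pprod (ts @ [(a, d)])) d) = k" "other_cycles (pprod (ts @ [(a, d)])) A d = \<beta>"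
      using cut(5,6) orb rst m by simp_all
    ultimately have "ts @ [(a, d)] \<in> rooted A k \<beta>"
      using d by (simp add: rooted_def pointed_def d_def)
    then show ?thesis
      using con cut(4) by (simp add: g_def a_def[symmetric] d_def[symmetric])
  qed
  have g: "g ts \<in> ?X \<and> ?f (g ts) = ts" if ts: "ts \<in> ?Y" for ts
  proof -
    have tsr: "ts \<in> rooted A k \<beta>" using ts by simp
    obtain ts' a where ts': "ts = ts' @ [(a, d)]" and a: "a \<in> A" "a \<noteq> d" and wf: "wf_list A ts'"
      and "ts \<in> conn A" and len: "Suc (length ts) = card A + size \<beta>" and orb: "card (orbit (pprod ts) d) = k"
      and rst: "other_cycles (pprod ts) A d = \<beta>"
      unfolding d_def by (rule rooted_snoc_cases[OF fin card tsr])
    have con: "ts' \<in> conn A" using ts by (simp add: ts')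
    have "a \<in> orbit (pprod ts') d"
    proof (rule ccontr)
      assume "a \<notin> orbit (pprod ts') d"
      from type_snoc_other_cycle[OF fin wf d a(1) this] conn_length[OF fin con d]
      show False using len rst by (simp add: ts')
    qed
    then obtain i where i: "0 < i" "a = (pprod ts' ^^ i) d" "card (orbit (pprod (ts' @ [(a, d)])) a) = i"
      "card (orbit (pprod ts') d) = card (orbit (pprod (ts' @ [(a, d)])) d) + i"
      "other_cycles (pprod (ts' @ [(a, d)])) A d = add_mset i (other_cycles (pprod ts') A d)"
      using type_snoc_same_cycle[OF fin wf d a(2)] by blast
    have b: "\<beta> = add_mset i (other_cycles (pprod ts') A d)" using i(5) rst by (simp add: ts')
    have "ts' \<in> rooted A (k + i) (\<beta> - {#i#})"
      using con d i(4) orb len b by (simp add: rooted_def pointed_def d_def[symmetric] ts')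
    moreover have "i \<in># \<beta>" using b by simp
    moreover have "g ts = (i, ts')" using i(3) by (simp add: g_def ts')
    ultimately show ?thesis using i(2) by (simp add: ts' d_def[symmetric])
  qed
  show ?thesis
  proof (rule bij_betw_byWitness[where f' = g])
    show "\<forall>x\<in>?X. g (?f x) = x" "?f ` ?X \<subseteq> ?Y"
      using f by auto
    show "\<forall>x\<in>?Y. ?f (g x) = x" "g ` ?Y \<subseteq> ?X"
      using g by blast+
  qed
qed

text \<open>B is the component of the smaller entry a of the last transposition. The piece on A - B
  keeps the maximum as its root, while a may be any point of B, hence
  \<open>pointed\<close>.\<close>

lemma bij_betw_split:
  assumes fin: "finite A" and card: "card A \<ge> 2"
  shows "bij_betw (\<lambda>(i, \<gamma>, B, ts1, ts2, a). merge ts1 ts2 @ [(a, Max A)])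
    (Sigma {1..<k} (\<lambda>i. Sigma {\<gamma>. \<gamma> \<subseteq># \<beta>} (\<lambda>\<gamma>. Sigma (Pow (A - {Max A}))
      (\<lambda>B. rooted (A - B) i \<gamma> \<times> pointed B (k - i) (\<beta> - \<gamma>)))))
    {ts \<in> rooted A k \<beta>. butlast ts \<notin> conn A}"
    (is "bij_betw ?f ?X ?Y")
proof -
  define d where "d = Max A"
  have d: "d \<in> A" using fin card unfolding d_def by (intro Max_in) auto
  have MaxB: "Max (A - B) = d" if "d \<notin> B" for B
    using fin d that by (intro Max_eqI) (auto simp: d_def)
  define g where "g ts = (let ts' = butlast ts; a = fst (last ts); B = {z \<in> A. (a, z) \<in> linked ts'};
      ts1 = restr (A - B) ts'; ts2 = restr B ts' in
      (card (orbit (pprod ts1) d), other_cycles (pprod ts1) (A - B) d, B, ts1, ts2, a))" for ts :: "(nat \<times> nat) list"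
  have cardA: "card A = card (A - B) + card B" if "B \<subseteq> A" for B
    using fin that by (metis card_Diff_subset card_mono finite_subset le_add_diff_inverse2)
  have f: "merge ts1 ts2 @ [(a, d)] \<in> ?Y \<and> g (merge ts1 ts2 @ [(a, d)]) = (i, \<gamma>, B, ts1, ts2, a)"
    if i: "i \<in> {1..<k}" and \<gamma>: "\<gamma> \<subseteq># \<beta>" and B: "B \<subseteq> A - {d}" and ts1: "ts1 \<in> rooted (A - B) i \<gamma>"
      and ts2: "(ts2, a) \<in> pointed B (k - i) (\<beta> - \<gamma>)" for i \<gamma> B ts1 ts2 a
  proof -
    have BA: "B \<subseteq> A" and dB: "d \<in> A - B" "d \<notin> B" using B d by auto
    have 1: "ts1 \<in> conn (A - B)" "Suc (length ts1) = card (A - B) + size \<gamma>"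
      "card (orbit (pprod ts1) d) = i" "other_cycles (pprod ts1) (A - B) d = \<gamma>"
      using ts1 by (auto simp: rooted_def pointed_def MaxB[OF dB(2)])
    have 2: "ts2 \<in> conn B" "a \<in> B" "Suc (length ts2) = card B + size (\<beta> - \<gamma>)"
      "card (orbit (pprod ts2) a) = k - i" "other_cycles (pprod ts2) B a = \<beta> - \<gamma>"
      using ts2 by (auto simp: pointed_def)
    note ctx = fin BA 1(1) 2(1) dB(1) 2(2)
    have "Suc (length (merge ts1 ts2 @ [(a, d)])) = card A + size \<beta>"
      using 1(2) 2(3) cardA[OF BA] \<gamma> size_mset_mono[OF \<gamma>] by (simp add: size_Diff_submset)
    then have "merge ts1 ts2 @ [(a, d)] \<in> rooted A k \<beta>"
      using merge_conn[OF ctx d_def] merge_type[OF ctx] 1 2 d i \<gamma>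
      by (simp add: rooted_def pointed_def d_def[symmetric])
    moreover have "g (merge ts1 ts2 @ [(a, d)]) = (i, \<gamma>, B, ts1, ts2, a)"
      by (simp add: g_def Let_def merge_component[OF ctx] restr_parts[OF ctx] 1)
    ultimately show ?thesis using merge_not_conn[OF ctx] by simp
  qed
  have g: "g ts \<in> ?X \<and> ?f (g ts) = ts" if ts: "ts \<in> ?Y" for ts
  proof -
    have tsr: "ts \<in> rooted A k \<beta>" using ts by simp
    obtain ts' a where ts': "ts = ts' @ [(a, d)]" and a: "a \<in> A" "a \<noteq> d" and wf: "wf_list A ts'"
      and con: "ts \<in> conn A"
      and len: "Suc (length ts) = card A + size \<beta>" and orb: "card (orbit (pprod ts) d) = k"
      and rst: "other_cycles (pprod ts) A d = \<beta>"
      unfolding d_def by (rule rooted_snoc_cases[OF fin card tsr])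
    have ncon: "ts' \<notin> conn A" using ts by (simp add: ts')
    define B where "B = {z \<in> A. (a, z) \<in> linked ts'}"
    define ts1 where "ts1 = restr (A - B) ts'"
    define ts2 where "ts2 = restr B ts'"
    define i where "i = card (orbit (pprod ts1) d)"
    define \<gamma> where "\<gamma> = other_cycles (pprod ts1) (A - B) d"
    have gts: "g ts = (i, \<gamma>, B, ts1, ts2, a)"
      by (simp add: g_def Let_def ts' B_def ts1_def ts2_def i_def \<gamma>_def)
    note split = conn_split[OF a(1) d con[unfolded ts'] ncon, folded B_def, folded ts1_def ts2_def]
    have BA: "B \<subseteq> A" by (auto simp: B_def)
    then have finB: "finite B" "finite (A - B)" using fin finite_subset by auto
    have dB: "d \<in> A - B" using d split(2) by simp
    note ctx = fin BA split(3,4) dB split(1)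
    have type: "k = i + card (orbit (pprod ts2) a)" "\<beta> = \<gamma> + other_cycles (pprod ts2) B a"
      using merge_type[OF ctx] orb rst by (simp_all add: split(5) ts' i_def \<gamma>_def)
    have len': "length ts' = length ts1 + length ts2"
      using arg_cong[OF split(5), of length] by simp
    have l1: "card (A - B) + size \<gamma> \<le> Suc (length ts1)"
      unfolding \<gamma>_def by (rule conn_length[OF finB(2) split(3) dB])
    have l2: "card B + size (other_cycles (pprod ts2) B a) \<le> Suc (length ts2)"
      by (rule conn_length[OF finB(1) split(4,1)])
    have sz: "size \<beta> = size \<gamma> + size (other_cycles (pprod ts2) B a)" by (simp add: type(2))
    \<comment> \<open>The two genus inequalities add up to the equality \<open>len\<close>, so each
      is an equality: both pieces have genus zero.\<close>
    have l: "Suc (length ts1) = card (A - B) + size \<gamma>" "Suc (length ts2) = card B + size (other_cycles (pprod ts2) B a)"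
      using l1 l2 len len' cardA[OF BA] sz by (simp_all add: ts')
    have "i > 0" "card (orbit (pprod ts2) a) > 0"
      unfolding i_def using card_orbit_pos[OF conn_permutes[OF split(3)] finB(2)] card_orbit_pos[OF conn_permutes[OF split(4)] finB(1)] by blast+
    then have "i \<in> {1..<k}" using type(1) by auto
    moreover have "\<gamma> \<subseteq># \<beta>" by (simp add: type(2))
    moreover have "B \<in> Pow (A - {d})" using BA dB by auto
    moreover have "ts1 \<in> rooted (A - B) i \<gamma>"
      using split(3) dB l(1) MaxB[of B] by (simp add: rooted_def pointed_def i_def \<gamma>_def)
    moreover have "(ts2, a) \<in> pointed B (k - i) (\<beta> - \<gamma>)"
      using split(4,1) l(2) type by (simp add: pointed_def)
    ultimately show ?thesis unfolding gts by (simp add: split(5) ts' d_def[symmetric])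
  qed
  show ?thesis
  proof (rule bij_betw_byWitness[where f' = g])
    show "\<forall>x\<in>?X. g (?f x) = x" "?f ` ?X \<subseteq> ?Y"
      using f unfolding d_def by (auto simp: Pow_def)
    show "\<forall>x\<in>?Y. ?f (g x) = x" "g ` ?Y \<subseteq> ?X"
      using g by blast+
  qed
qed

lemma card_rooted:
  assumes fin: "finite A" and card: "card A \<ge> 2" and k: "k \<ge> 1" and \<beta>: "0 \<notin># \<beta>"
  shows "card (rooted A k \<beta>) = (\<Sum>m\<in>set_mset \<beta>. card (rooted A (k + m) (\<beta> - {#m#}))) +
    (\<Sum>i\<in>{1..<k}. \<Sum>\<gamma> | \<gamma> \<subseteq># \<beta>. \<Sum>B\<in>Pow (A - {Max A}).
      card (rooted (A - B) i \<gamma>) * card (pointed B (k - i) (\<beta> - \<gamma>)))"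
proof -
  have finB: "finite (rooted (A - B) i \<gamma> \<times> pointed B j \<delta>)" if "B \<in> Pow (A - {Max A})" for B i j \<gamma> \<delta>
    using that fin by (intro finite_cartesian_product finite_rooted finite_pointed) (auto intro: finite_subset)
  have finP: "finite (Pow (A - {Max A}))" using fin by simp
  have "card (rooted A k \<beta>) = card {ts \<in> rooted A k \<beta>. butlast ts \<in> conn A} + card {ts \<in> rooted A k \<beta>. butlast ts \<notin> conn A}"
    using finite_rooted[OF fin] by (subst card_Un_disjoint[symmetric]) (auto intro!: arg_cong[where f = card])
  also have "card {ts \<in> rooted A k \<beta>. butlast ts \<in> conn A} = (\<Sum>m\<in>set_mset \<beta>. card (rooted A (k + m) (\<beta> - {#m#})))"
    unfolding bij_betw_same_card[OF bij_betw_cut[OF fin card k \<beta>], symmetric]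
    by (rule card_SigmaI) (use finite_rooted[OF fin] in auto)
  also have "card {ts \<in> rooted A k \<beta>. butlast ts \<notin> conn A} =
    (\<Sum>i\<in>{1..<k}. \<Sum>\<gamma> | \<gamma> \<subseteq># \<beta>. \<Sum>B\<in>Pow (A - {Max A}).
      card (rooted (A - B) i \<gamma>) * card (pointed B (k - i) (\<beta> - \<gamma>)))"
  proof -
    define C where "C i \<gamma> = Sigma (Pow (A - {Max A})) (\<lambda>B. rooted (A - B) i \<gamma> \<times> pointed B (k - i) (\<beta> - \<gamma>))" for i \<gamma>
    have finC: "finite (C i \<gamma>)" for i \<gamma>
      unfolding C_def by (intro finite_SigmaI finP finB)
    have "card (Sigma {1..<k} (\<lambda>i. Sigma {\<gamma>. \<gamma> \<subseteq># \<beta>} (C i))) = (\<Sum>i\<in>{1..<k}. card (Sigma {\<gamma>. \<gamma> \<subseteq># \<beta>} (C i)))"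
      by (intro card_SigmaI ballI finite_SigmaI finite_submultisets finC) simp
    also have "\<dots> = (\<Sum>i\<in>{1..<k}. \<Sum>\<gamma> | \<gamma> \<subseteq># \<beta>. card (C i \<gamma>))"
      by (intro sum.cong refl card_SigmaI ballI finite_submultisets finC)
    also have "\<dots> = (\<Sum>i\<in>{1..<k}. \<Sum>\<gamma> | \<gamma> \<subseteq># \<beta>. \<Sum>B\<in>Pow (A - {Max A}).
        card (rooted (A - B) i \<gamma>) * card (pointed B (k - i) (\<beta> - \<gamma>)))"
    proof (intro sum.cong refl)
      fix i \<gamma>
      have "card (C i \<gamma>) = (\<Sum>B\<in>Pow (A - {Max A}). card (rooted (A - B) i \<gamma> \<times> pointed B (k - i) (\<beta> - \<gamma>)))"
        unfolding C_def by (intro card_SigmaI ballI finP finB)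
      then show "card (C i \<gamma>) = (\<Sum>B\<in>Pow (A - {Max A}). card (rooted (A - B) i \<gamma>) * card (pointed B (k - i) (\<beta> - \<gamma>)))"
        by (simp add: card_cartesian_product)
    qed
    finally show ?thesis unfolding C_def bij_betw_same_card[OF bij_betw_split[OF fin card], symmetric] .
  qed
  finally show ?thesis .
qed

subsection \<open>The count\<close>

text \<open>With \<alpha> = \<open>add_mset k \<beta>\<close>, the first factor is the number of
  points on k-cycles and the rest depends on \<alpha> alone. This is the proportionality that makes
  the marked point harmless.\<close>

lemma rooted_number_add_mset:
  "rooted_number k \<beta> = real (k * Suc (count \<beta> k)) * (weight (add_mset k \<beta>) *
     rising (2 * real (k + sum_mset \<beta>) + 1) (int (size \<beta>) - 2))"
proof -
  have "2 * real (k + sum_mset \<beta>) + 1 = 2 * real k + 2 * real (sum_mset \<beta>) + 1" by simp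
  then have "rooted_number k \<beta> = real k * (cbin k * weight \<beta>) * rising (2 * real (k + sum_mset \<beta>) + 1) (int (size \<beta>) - 2)"
    by (simp only: rooted_number_def hurwitz_shifted_def mult.assoc)
  also have "cbin k * weight \<beta> = real (Suc (count \<beta> k)) * weight (add_mset k \<beta>)"
    by (rule weight_add_mset[symmetric])
  finally show ?thesis by (simp only: of_nat_mult mult_ac)
qed

text \<open>The numbers of points on k-cycles sum to \<open>card A\<close> over the distinct k,
  which turns the factorial of \<open>card A - 1\<close> into that of \<open>card A\<close>.\<close>

lemma card_of_type_formula:
  assumes fin: "finite A" and ne: "A \<noteq> {}" and \<alpha>: "0 \<notin># \<alpha>" "card A = sum_mset \<alpha>"
    and rooted: "\<And>k \<beta>. \<alpha> = add_mset k \<beta> \<Longrightarrow> real (card (rooted A k \<beta>)) = fact (card A - 1) * rooted_number k \<beta>"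
  shows "real (card (of_type A \<alpha>)) = fact (card A) * (weight \<alpha> * rising (2 * real (card A) + 1) (int (size \<alpha>) - 3))"
proof -
  define N where "N = weight \<alpha> * rising (2 * real (card A) + 1) (int (size \<alpha>) - 3)"
  have "real (card (of_type A \<alpha>)) = (\<Sum>k\<in>set_mset \<alpha>. real (card (rooted A k (\<alpha> - {#k#}))))"
    by (simp add: card_of_type[OF fin ne])
  also have "\<dots> = (\<Sum>k\<in>set_mset \<alpha>. real (count \<alpha> k) * (real k * (fact (card A - 1) * N)))"
  proof (rule sum.cong)
    fix k assume k: "k \<in># \<alpha>"
    then obtain \<beta> where \<beta>: "\<alpha> = add_mset k \<beta>" by (metis mset_add)
    have "rooted_number k \<beta> = real (k * count \<alpha> k) * N"
      unfolding rooted_number_add_mset N_def \<alpha>(2) by (simp add: \<beta>)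
    then show "real (card (rooted A k (\<alpha> - {#k#}))) = real (count \<alpha> k) * (real k * (fact (card A - 1) * N))"
      using rooted[OF \<beta>] by (simp add: \<beta> algebra_simps)
  qed simp
  also have "\<dots> = (\<Sum>k\<in>#\<alpha>. real k * (fact (card A - 1) * N))"
    by (rule sum_count_eq_sum_mset)
  also have "\<dots> = real (card A) * (fact (card A - 1) * N)"
    by (simp add: \<alpha>(2) sum_mset_distrib_right)
  also have "\<dots> = fact (card A) * N"
    using fin ne by (simp add: fact_reduce[of "card A"] card_gt_0_iff)
  finally show ?thesis by (simp add: N_def)
qed

text \<open>An arbitrary marked point counts \<open>card A\<close> times as much as the maximum,
  because \<open>card_pointed\<close> and \<open>rooted_number_add_mset\<close> carry the same
  factor.\<close>

lemma card_pointed_formula: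
  assumes fin: "finite A" and ne: "A \<noteq> {}" and \<gamma>: "k \<ge> 1" "0 \<notin># \<gamma>" "card A = k + sum_mset \<gamma>"
    and rooted: "\<And>i \<beta>. add_mset k \<gamma> = add_mset i \<beta> \<Longrightarrow> real (card (rooted A i \<beta>)) = fact (card A - 1) * rooted_number i \<beta>"
  shows "real (card (pointed A k \<gamma>)) = fact (card A) * rooted_number k \<gamma>"
proof -
  have "real (card (of_type A (add_mset k \<gamma>))) =
      fact (card A) * (weight (add_mset k \<gamma>) * rising (2 * real (card A) + 1) (int (size (add_mset k \<gamma>)) - 3))"
    by (rule card_of_type_formula[OF fin ne]) (use \<gamma> rooted in auto)
  then show ?thesis
    unfolding card_pointed[OF fin] rooted_number_add_mset \<gamma>(3)[symmetric] of_nat_mult by simp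
qed

lemma card_rooted_singleton: "card (rooted {d} 1 {#}) = 1"
proof -
  have "orbit id d = {d}" using orbit_eq_singleton_iff[of id d] by simp
  then have "rooted {d} 1 {#} = {[]}"
    by (auto simp: rooted_def pointed_def conn_singleton other_cycles_def)
  then show ?thesis by simp
qed

lemma rooted_number_singleton: "rooted_number 1 {#} = 1"
  by (simp add: rooted_number_def hurwitz_shifted_def rising_def cbin_def pochhammer_rec numeral_2_eq_2)

lemma sum_over_subsets_by_card:
  fixes f :: "nat \<Rightarrow> real"
  assumes fin: "finite S" and s: "s \<le> card S"
  shows "(\<Sum>B\<in>Pow S. if card B = s then c else 0) = real (card S choose s) * c"
proof -
  have "(\<Sum>B\<in>Pow S. if card B = s then c else 0) = (\<Sum>B\<in>{B \<in> Pow S. card B = s}. c)"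
    by (rule sum.inter_filter[symmetric]) (use fin in simp)
  also have "{B \<in> Pow S. card B = s} = {B. B \<subseteq> S \<and> card B = s}" by auto
  finally show ?thesis using n_subsets[OF fin, of s] by simp
qed

text \<open>Induction on \<open>card A + size \<beta>\<close>: a cut keeps A but takes a part from
  \<beta>, and a split has smaller ground sets, since B is nonempty and misses the maximum.\<close>

theorem card_rooted_formula:
  assumes "finite A" "k \<ge> 1" "0 \<notin># \<beta>" "card A = k + sum_mset \<beta>"
  shows "real (card (rooted A k \<beta>)) = fact (card A - 1) * rooted_number k \<beta>"
  using assms
proof (induction "card A + size \<beta>" arbitrary: A k \<beta> rule: less_induct)
  case less
  note fin = less.prems(1) and k = less.prems(2) and \<beta> = less.prems(3) and A = less.prems(4)
  show ?case
  proof (cases "card A \<ge> 2")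
    case False
    then have c: "card A = 1" "k = 1" "sum_mset \<beta> = 0" using A k by linarith+
    then obtain d where d: "A = {d}" by (metis card_1_singletonE)
    have "\<beta> = {#}" using c(3) \<beta> by (cases \<beta>) auto
    then show ?thesis using c d card_rooted_singleton rooted_number_singleton by simp
  next
    case True
    define n where "n = card A - 1"
    have n: "card A = Suc n" using True by (simp add: n_def)
    define S where "S = A - {Max A}"
    have MA: "Max A \<in> A" using fin True by (intro Max_in) auto
    have S: "finite S" "card S = n" using fin MA by (simp_all add: S_def n_def)
    have cut: "(\<Sum>m\<in>set_mset \<beta>. real (card (rooted A (k + m) (\<beta> - {#m#})))) = fact n * shift (\<lambda>m. rooted_number (k + m)) \<beta>"
      unfolding shift_def sum_distrib_left
    proof (rule sum.cong)
      fix m assume m: "m \<in># \<beta>"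
      then obtain \<gamma> where \<gamma>: "\<beta> = add_mset m \<gamma>" by (metis mset_add)
      show "real (card (rooted A (k + m) (\<beta> - {#m#}))) = fact n * rooted_number (k + m) (\<beta> - {#m#})"
        unfolding n_def by (rule less.hyps) (use \<gamma> fin k \<beta> A in auto)
    qed simp
    have split: "(\<Sum>B\<in>Pow S. real (card (rooted (A - B) i \<gamma>) * card (pointed B (k - i) (\<beta> - \<gamma>)))) =
        fact n * (rooted_number i \<gamma> * rooted_number (k - i) (\<beta> - \<gamma>))" if i: "i \<in> {1..<k}" and \<gamma>: "\<gamma> \<subseteq># \<beta>" for i \<gamma>
    proof -
      \<comment> \<open>The only cardinality of B that fits the type of the second piece.\<close>
      define s where "s = k - i + sum_mset (\<beta> - \<gamma>)"
      obtain \<delta> where \<delta>: "\<beta> = \<gamma> + \<delta>" using \<gamma> by (metis subset_mset.le_iff_add)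
      have z: "0 \<notin># \<gamma>" "0 \<notin># \<delta>" using \<beta> by (auto simp: \<delta>)
      have s: "s \<le> n" "n - s = i + sum_mset \<gamma> - 1" "s \<ge> 1" "s + (i + sum_mset \<gamma>) = card A"
        using i A n by (auto simp: s_def \<delta>)
      have summand: "real (card (rooted (A - B) i \<gamma>) * card (pointed B (k - i) (\<beta> - \<gamma>))) =
          (if card B = s then fact (n - s) * fact s * (rooted_number i \<gamma> * rooted_number (k - i) (\<beta> - \<gamma>)) else 0)" if B: "B \<in> Pow S" for B
      proof (cases "card B = s")
        case True
        have BA: "B \<subseteq> A" "finite B" using B fin S(1) finite_subset by (auto simp: S_def)
        have cAB: "card (A - B) = i + sum_mset \<gamma>"
          using True s(4) card_Diff_subset[OF BA(2,1)] by simp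
        have "real (card (rooted (A - B) i \<gamma>)) = fact (card (A - B) - 1) * rooted_number i \<gamma>"
          by (rule less.hyps) (use cAB i z \<delta> fin s in auto)
        moreover have "real (card (pointed B (k - i) (\<beta> - \<gamma>))) = fact (card B) * rooted_number (k - i) (\<beta> - \<gamma>)"
        proof (rule card_pointed_formula[OF BA(2)])
          show "B \<noteq> {}" using True s(3) by auto
          \<comment> \<open>The marked point of B need not be its maximum, so the hypothesis is
            needed for every cycle length j that the maximum of B can have.\<close>
          show "real (card (rooted B j \<epsilon>)) = fact (card B - 1) * rooted_number j \<epsilon>" if "add_mset (k - i) (\<beta> - \<gamma>) = add_mset j \<epsilon>" for j \<epsilon>
          proof (rule less.hyps)
            have sz: "size \<epsilon> = size \<delta>" using arg_cong[OF that, of size] by (simp add: \<delta>)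
            show "card B + size \<epsilon> < card A + size \<beta>" using sz True s \<delta> i by simp
            have "0 \<notin># add_mset (k - i) (\<beta> - \<gamma>)" using i z \<delta> by auto
            then show "j \<ge> 1" "0 \<notin># \<epsilon>" unfolding that by (auto simp: Suc_le_eq)
            show "card B = j + sum_mset \<epsilon>" using arg_cong[OF that, of sum_mset] True by (simp add: s_def)
          qed (rule BA(2))
        qed (use i z \<delta> True in \<open>auto simp: s_def\<close>)
        ultimately show ?thesis using True cAB s(2) by simp
      next
        case False
        have "pointed B (k - i) (\<beta> - \<gamma>) = {}"
        proof (rule ccontr)
          assume "pointed B (k - i) (\<beta> - \<gamma>) \<noteq> {}"
          then obtain ts x where "(ts, x) \<in> pointed B (k - i) (\<beta> - \<gamma>)" by auto
          moreover have "finite B" using B S(1) finite_subset by auto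
          ultimately show False using card_pointed_nonempty False by (simp add: s_def)
        qed
        then show ?thesis using False by simp
      qed
      have "(\<Sum>B\<in>Pow S. real (card (rooted (A - B) i \<gamma>) * card (pointed B (k - i) (\<beta> - \<gamma>)))) =
          (\<Sum>B\<in>Pow S. if card B = s then fact (n - s) * fact s * (rooted_number i \<gamma> * rooted_number (k - i) (\<beta> - \<gamma>)) else 0)"
        by (intro sum.cong refl) (rule summand)
      also have "\<dots> = real (n choose s) * (fact (n - s) * fact s * (rooted_number i \<gamma> * rooted_number (k - i) (\<beta> - \<gamma>)))"
        using sum_over_subsets_by_card[OF S(1), of s] S(2) s(1) by simp
      also have "\<dots> = fact n * (rooted_number i \<gamma> * rooted_number (k - i) (\<beta> - \<gamma>))"
        using binomial_fact[OF s(1), where ?'a = real] by (simp add: field_simps)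
      finally show ?thesis .
    qed
    have "real (card (rooted A k \<beta>)) = (\<Sum>m\<in>set_mset \<beta>. real (card (rooted A (k + m) (\<beta> - {#m#})))) +
      (\<Sum>i\<in>{1..<k}. \<Sum>\<gamma> | \<gamma> \<subseteq># \<beta>. \<Sum>B\<in>Pow S. real (card (rooted (A - B) i \<gamma>) * card (pointed B (k - i) (\<beta> - \<gamma>))))"
      unfolding card_rooted[OF fin True k \<beta>] S_def by simp
    also have "\<dots> = fact n * shift (\<lambda>m. rooted_number (k + m)) \<beta> +
      (\<Sum>i\<in>{1..<k}. \<Sum>\<gamma> | \<gamma> \<subseteq># \<beta>. fact n * (rooted_number i \<gamma> * rooted_number (k - i) (\<beta> - \<gamma>)))"
      unfolding cut by (intro arg_cong2[where f = "(+)"] refl sum.cong split) auto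
    also have "\<dots> = fact n * (shift (\<lambda>m. rooted_number (k + m)) \<beta> + (\<Sum>i\<in>{1..<k}. convolve (rooted_number i) (rooted_number (k - i)) \<beta>))"
      by (simp add: convolve_def sum_distrib_left distrib_left)
    also have "\<dots> = fact n * rooted_number k \<beta>"
    proof -
      have "k \<noteq> 1 \<or> \<beta> \<noteq> {#}" using True A by auto
      then show ?thesis using rooted_number_recursion[OF k] by simp
    qed
    finally show ?thesis by (simp add: n_def)
  qed
qed

section \<open>Translation from the symmetric group to lists and graphs\<close>

lemma foldr_transpositions: "foldr (mult (sym_group d)) (transpositions ts) (one (sym_group d)) = pprod ts"
  by (induction ts) (auto simp: transpositions_def sym_group_def pprod_def)

lemma generate_linked:
  assumes "h \<in> generate (sym_group d) (set (transpositions ts))" and wf: "wf_list {1..d} ts"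
  shows "(x, h x) \<in> linked ts"
  using assms(1)
proof (induction arbitrary: x rule: generate.induct)
  case one
  then show ?case by (simp add: sym_group_def)
next
  case (incl h)
  then obtain a b where h: "(a, b) \<in> set ts" "h = Transposition.transpose a b" by (auto simp: transpositions_def)
  then show ?case using linked_edge[OF h(1)] linked_sym[OF linked_edge[OF h(1)]] by (auto simp: transpose_def)
next
  case (inv h)
  then obtain a b where h: "(a, b) \<in> set ts" "h = Transposition.transpose a b" by (auto simp: transpositions_def)
  have "h permutes {1..d}"
    unfolding h(2) by (rule permutes_swap_id) (use wf h(1) in \<open>auto simp: wf_list_def\<close>)
  then have "m_inv (sym_group d) h = h"
    by (intro group.inv_equality[OF sym_group_is_group]) (auto simp: sym_group_def h(2))
  then show ?case
    using h linked_edge[OF h(1)] linked_sym[OF linked_edge[OF h(1)]] by (auto simp: transpose_def)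
next
  case (eng h1 h2)
  have "(x, h2 x) \<in> linked ts" "(h2 x, h1 (h2 x)) \<in> linked ts" using eng.IH by auto
  then show ?case by (simp add: sym_group_def linked_trans)
qed

lemma linked_generate:
  assumes "(x, y) \<in> linked ts"
  shows "\<exists>h\<in>generate (sym_group d) (set (transpositions ts)). h x = y"
  using assms
proof (induction rule: linked_induct)
  case refl
  have "id \<in> generate (sym_group d) (set (transpositions ts))"
    using generate.one[of "sym_group d"] by (simp add: sym_group_def)
  then show ?case by (intro bexI[of _ id]) auto
next
  case (step y z)
  then obtain h where h: "h \<in> generate (sym_group d) (set (transpositions ts))" "h x = y" by auto
  obtain a b where ab: "(a, b) \<in> set ts" "Transposition.transpose a b y = z"
    using step.hyps(2) by auto
  have "Transposition.transpose a b \<in> generate (sym_group d) (set (transpositions ts))"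
    using ab(1) by (intro generate.incl) (force simp: transpositions_def)
  from generate.eng[OF this h(1)]
  have "Transposition.transpose a b \<circ> h \<in> generate (sym_group d) (set (transpositions ts))"
    by (simp add: sym_group_def)
  then show ?case using h(2) ab(2) by (intro bexI[of _ "Transposition.transpose a b \<circ> h"]) auto
qed

text \<open>Each generated element moves a point along edges, and a path composes to a generated
  element.\<close>

lemma transitive_on_iff_linked:
  assumes "wf_list {1..d} ts"
  shows "transitive_on d (generate (sym_group d) (set (transpositions ts))) \<longleftrightarrow>
    (\<forall>x\<in>{1..d}. \<forall>y\<in>{1..d}. (x, y) \<in> linked ts)"
  unfolding transitive_on_def using generate_linked[OF _ assms] linked_generate by metis

lemma monotone_factorizations_eq:
  assumes "sum_mset \<alpha> = d" "r + 2 = d + size \<alpha>"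
  shows "monotone_factorizations r \<alpha> = of_type {1..d} \<alpha>"
proof -
  have "ts \<in> monotone_factorizations r \<alpha> \<longleftrightarrow> wf_list {1..d} ts \<and>
      transitive_on d (generate (sym_group d) (set (transpositions ts))) \<and>
      length ts + 2 = d + size \<alpha> \<and> ctype (pprod ts) {1..d} = \<alpha>" for ts
    using assms by (fastforce simp: monotone_factorizations_def wf_list_def foldr_transpositions
        cycle_type_def ctype_def Let_def)
  then show ?thesis
    using transitive_on_iff_linked by (auto simp: of_type_def conn_def)
qed

theorem theorem1p1:
  fixes d :: nat and \<alpha> :: "nat multiset"
  assumes "d \<ge> 1" and "partition_of \<alpha> d"
  shows "real (monotone_hurwitz_genus 0 \<alpha>) =
    fact d / real (aut_order \<alpha>) * rising (2 * real d + 1) (int (size \<alpha>) - 3) *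
    (\<Prod>a\<in>#\<alpha>. real ((2 * a) choose a))"
proof -
  have \<alpha>: "0 \<notin># \<alpha>" "sum_mset \<alpha> = d" using assms(2) by (auto simp: partition_of_def)
  have "size \<alpha> \<ge> 1" using \<alpha> assms(1) by (cases \<alpha>) auto
  \<comment> \<open>There is at least one point and one part, so the truncated subtraction is
    exact.\<close>
  then have r: "d + size \<alpha> - 2 + 2 = d + size \<alpha>" using assms(1) by simp
  have "monotone_hurwitz_genus 0 \<alpha> = card (of_type {1..d} \<alpha>)"
    using monotone_factorizations_eq[OF \<alpha>(2) r] by (simp add: monotone_hurwitz_genus_def monotone_hurwitz_def \<alpha>(2))
  also have "real \<dots> = fact (card {1..d}) * (weight \<alpha> * rising (2 * real (card {1..d}) + 1) (int (size \<alpha>) - 3))"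
  proof (rule card_of_type_formula)
    fix k \<beta> assume "\<alpha> = add_mset k \<beta>"
    then show "real (card (rooted {1..d} k \<beta>)) = fact (card {1..d} - 1) * rooted_number k \<beta>"
      using \<alpha> by (intro card_rooted_formula) (auto simp: Suc_le_eq)
  qed (use \<alpha> assms in auto)
  finally show ?thesis by (simp add: weight_def cbin_def)
qed

end
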